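(* Let $J$ be a Jacobi operator in $l_2(\mathbb{N})$. Bases are counted modulo reflection, where reflection means that every element of the orthonormal basis is multiplied by $-1$. Then: (i) if for $J$ there is more than one basis of representation such that the corresponding matrix representation of $J$ is a Jacobi matrix, then $J$ is selfadjoint; (ii) if for $J$ there is only one basis of representation such that the corresponding matrix representation of $J$ is a Jacobi matrix, then $J$ is nonselfadjoint.
   Context: Hilbert spaces are complex; inner products are antilinear in the first argument; $\mathbb{N}=\{1,2,\dots\}$. Basis of representation (also called basis of matrix representation): an orthonormal basis $\{u_k\}_{k=1}^\infty$ of a Hilbert space is a basis of representation for a closed operator $A$ if (a) $u_k\in\operatorname{dom}A$ for all $k$, and (b) every closed operator $B$ with $Bu_k=Au_k$ for all $k$ satisfies $B\supset A$. Then the matrix with entries $a_{kj}=\langle u_k,Au_j\rangle$ is the matrix representation of $A$ with respect to $\{u_k\}$. Jacobi matrix: a semi-infinite tridiagonal matrix with real diagonal entries $q_1,q_2,\dots$ and with positive entries $b_1,b_2,\dots$ on both the sub- and superdiagonal (entries $(k,k+1)$ and $(k+1,k)$ equal to $b_k$), all other entries being zero. Jacobi operator: given a Jacobi matrix, the associated Jacobi operator $J$ is the unique closed symmetric operator in $l_2(\mathbb{N})$ having this matrix as its matrix representation with respect to the canonical basis $\{\delta_k\}_{k=1}^\infty$; i.e. $J$ is the closure of the operator defined on finitely supported sequences by $(J_0\phi)_1=q_1\phi_1+b_1\phi_2$, $(J_0\phi)_k=b_{k-1}\phi_{k-1}+q_k\phi_k+b_k\phi_{k+1}$ for $k\ge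2$.
   Formalization: Bases are counted modulo multiplying all elements by one common unimodular complex number, not only by −1; with −1 alone, {δ_k} and {iδ_k} would be two bases for every Jacobi operator, so (i) would be false for nonselfadjoint J and (ii) vacuous. *)

theory Defs
  imports "HOL-Analysis.Analysis"
begin

section \<open>Complex Hilbert spaces\<close>

text \<open>
  The real inner product of the library is the real part of the complex one, so norm,
  topology and completeness are the library's. Positive definiteness is inherited from
  the class of real inner product spaces. The complex inner product is antilinear in the
  first argument.
\<close>

class chilbert_space = real_inner + complete_space +
  fixes scaleC :: "complex \<Rightarrow> 'a \<Rightarrow> 'a"  (infixr "*\<^sub>C" 75)
    and cinner :: "'a \<Rightarrow> 'a \<Rightarrow> complex"
  assumes scaleC_add_right: "scaleC c (x + y) = scaleC c x + scaleC c y"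
    and scaleC_add_left: "scaleC (c + d) x = scaleC c x + scaleC d x"
    and scaleC_scaleC: "scaleC c (scaleC d x) = scaleC (c * d) x"
    and scaleR_eq_scaleC: "scaleR r x = scaleC (complex_of_real r) x"
    and cinner_commute: "cinner x y = cnj (cinner y x)"
    and cinner_add_right: "cinner x (y + z) = cinner x y + cinner x z"
    and cinner_scaleC_right: "cinner x (scaleC c y) = c * cinner x y"
    and inner_eq_Re_cinner: "inner x y = Re (cinner x y)"


section \<open>Square-summable sequences\<close>

text \<open>Sequences are indexed from 0: index \<open>k\<close> here corresponds to \<open>k + 1\<close> in
  the convention where the natural numbers start at 1.\<close>

typedef ell2 = "{x :: nat \<Rightarrow> complex. summable (\<lambda>k. (cmod (x k))\<^sup>2)}"
  morphisms coord Abs_ell2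
  by (rule exI[of _ "\<lambda>_. 0"]) simp

lemma coord_summable: "summable (\<lambda>k. (cmod (coord x k))\<^sup>2)"
  using coord[of x] by simp

lemma coord_Abs: "summable (\<lambda>k. (cmod (f k))\<^sup>2) \<Longrightarrow> coord (Abs_ell2 f) = f"
  by (simp add: Abs_ell2_inverse)

lemma ell2_eqI: "(\<And>k. coord x k = coord y k) \<Longrightarrow> x = y"
  by (metis coord_inject ext)

lemma cmod_add_sq_le: "(cmod (a + b))\<^sup>2 \<le> 2 * (cmod a)\<^sup>2 + 2 * (cmod b)\<^sup>2"
proof -
  have "(cmod (a + b))\<^sup>2 \<le> (cmod a + cmod b)\<^sup>2"
    by (simp add: norm_triangle_ineq power_mono)
  also have "\<dots> \<le> 2 * (cmod a)\<^sup>2 + 2 * (cmod b)\<^sup>2"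
    using zero_le_power2[of "cmod a - cmod b"] by (simp add: power2_sum power2_diff)
  finally show ?thesis .
qed

lemma ell2_add_summable:
  assumes "summable (\<lambda>k. (cmod (f k))\<^sup>2)" "summable (\<lambda>k. (cmod (g k))\<^sup>2)"
  shows "summable (\<lambda>k. (cmod (f k + g k))\<^sup>2)"
  by (rule summable_comparison_test'[where N = 0,
        OF summable_add[OF summable_mult[OF assms(1), of 2] summable_mult[OF assms(2), of 2]]])
     (simp add: cmod_add_sq_le)

lemma ell2_scale_summable:
  assumes "summable (\<lambda>k. (cmod (f k))\<^sup>2)"
  shows "summable (\<lambda>k. (cmod (c * f k))\<^sup>2)"
  using summable_mult[OF assms, of "(cmod c)\<^sup>2"] by (simp add: norm_mult power_mult_distrib)

lemma ell2_cinner_summable: "summable (\<lambda>k. cnj (coord x k) * coord y k)"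
proof (rule summable_comparison_test'[where N = 0])
  show "summable (\<lambda>k. (cmod (coord x k))\<^sup>2 + (cmod (coord y k))\<^sup>2)"
    by (intro summable_add coord_summable)
  fix k
  have "0 \<le> (cmod (coord x k) - cmod (coord y k))\<^sup>2"
    by simp
  moreover have "0 \<le> cmod (coord x k) * cmod (coord y k)"
    by simp
  ultimately show "norm (cnj (coord x k) * coord y k)
      \<le> (cmod (coord x k))\<^sup>2 + (cmod (coord y k))\<^sup>2"
    unfolding norm_mult complex_mod_cnj power2_diff by linarith
qed

instantiation ell2 :: real_vector
begin

definition "0 = Abs_ell2 (\<lambda>_. 0)"
definition "x + y = Abs_ell2 (\<lambda>k. coord x k + coord y k)"
definition "- x = Abs_ell2 (\<lambda>k. - coord x k)" for x :: ell2
definition "x - y = Abs_ell2 (\<lambda>k. coord x k - coord y k)"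
definition "scaleR r x = Abs_ell2 (\<lambda>k. complex_of_real r * coord x k)"

lemma coord_zero [simp]: "coord 0 k = 0"
  unfolding zero_ell2_def by (subst coord_Abs) simp_all

lemma coord_add [simp]: "coord (x + y) k = coord x k + coord y k"
  unfolding plus_ell2_def by (subst coord_Abs) (simp_all add: ell2_add_summable coord_summable)

lemma coord_uminus [simp]: "coord (- x) k = - coord x k"
  unfolding uminus_ell2_def by (subst coord_Abs) (simp_all add: coord_summable)

lemma coord_diff [simp]: "coord (x - y) k = coord x k - coord y k"
proof -
  have "summable (\<lambda>k. (cmod (coord x k + coord (- y) k))\<^sup>2)"
    by (intro ell2_add_summable coord_summable)
  then show ?thesis
    unfolding minus_ell2_def by (subst coord_Abs) simp_all
qed

lemma coord_scaleR [simp]: "coord (r *\<^sub>R x) k = complex_of_real r * coord x k"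
  unfolding scaleR_ell2_def by (subst coord_Abs) (rule ell2_scale_summable coord_summable refl)+

instance
proof
  fix x y z :: ell2 and r s :: real
  show "x + y + z = x + (y + z)" "x + y = y + x" "0 + x = x" "- x + x = 0" "x - y = x + - y"
    by (rule ell2_eqI; simp)+
  show "r *\<^sub>R (x + y) = r *\<^sub>R x + r *\<^sub>R y" "(r + s) *\<^sub>R x = r *\<^sub>R x + s *\<^sub>R x"
    "r *\<^sub>R s *\<^sub>R x = (r * s) *\<^sub>R x" "1 *\<^sub>R x = x"
    by (rule ell2_eqI; simp add: algebra_simps)+
qed

end

instantiation ell2 :: real_inner
begin

definition "inner x y = Re (\<Sum>k. cnj (coord x k) * coord y k)"
definition "norm x = sqrt (inner x x)" for x :: ell2
definition "dist x y = norm (x - y)" for x y :: ell2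
definition "sgn x = x /\<^sub>R norm x" for x :: ell2
definition "(uniformity :: (ell2 \<times> ell2) filter) = (INF e\<in>{0<..}. principal {(x, y). dist x y < e})"
definition "open (U :: ell2 set) = (\<forall>x\<in>U. \<forall>\<^sub>F (x', y) in uniformity. x' = x \<longrightarrow> y \<in> U)"

lemma inner_ell2_self: "inner x x = (\<Sum>k. (cmod (coord x k))\<^sup>2)" for x :: ell2
proof -
  have "inner x x = Re (\<Sum>k. complex_of_real ((cmod (coord x k))\<^sup>2))"
    unfolding inner_ell2_def
    by (intro arg_cong[where f = Re] suminf_cong) (metis complex_norm_square mult.commute of_real_power)
  also have "\<dots> = (\<Sum>k. (cmod (coord x k))\<^sup>2)"
    by (subst suminf_of_real[OF coord_summable, symmetric]) simp
  finally show ?thesis .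
qed

instance
proof
  fix x y z :: ell2 and r :: real
  show "inner x y = inner y x"
  proof -
    have "cnj (\<Sum>k. cnj (coord x k) * coord y k) = (\<Sum>k. cnj (cnj (coord x k) * coord y k))"
      by (rule bounded_linear.suminf[OF bounded_linear_cnj ell2_cinner_summable])
    then have "cnj (\<Sum>k. cnj (coord x k) * coord y k) = (\<Sum>k. cnj (coord y k) * coord x k)"
      by (simp add: mult.commute)
    then show ?thesis
      unfolding inner_ell2_def by (metis complex_cnj(1) cnj.simps(1))
  qed
  show "inner (x + y) z = inner x z + inner y z"
    unfolding inner_ell2_def
    by (simp add: distrib_right suminf_add[OF ell2_cinner_summable ell2_cinner_summable, symmetric])
  show "inner (r *\<^sub>R x) y = r * inner x y"
    unfolding inner_ell2_def
    by (simp add: mult.assoc suminf_mult[OF ell2_cinner_summable])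
  show "0 \<le> inner x x"
    unfolding inner_ell2_self by (rule suminf_nonneg[OF coord_summable]) simp
  show "inner x x = 0 \<longleftrightarrow> x = 0"
    unfolding inner_ell2_self
    by (subst suminf_eq_zero_iff[OF coord_summable]) (auto intro: ell2_eqI)
qed (rule norm_ell2_def dist_ell2_def sgn_ell2_def uniformity_ell2_def open_ell2_def)+

end

lemma norm_ell2_sq: "(norm x)\<^sup>2 = (\<Sum>k. (cmod (coord x k))\<^sup>2)" for x :: ell2
  by (metis inner_ell2_self power2_norm_eq_inner)

lemma sum_coord_le_norm: "(\<Sum>k<K. (cmod (coord x k))\<^sup>2) \<le> (norm x)\<^sup>2"
  unfolding norm_ell2_sq by (rule sum_le_suminf[OF coord_summable]) auto

lemma cmod_coord_le_norm: "cmod (coord x k) \<le> norm x"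
proof -
  have "(cmod (coord x k))\<^sup>2 \<le> (\<Sum>j<Suc k. (cmod (coord x j))\<^sup>2)"
    by (simp add: sum_nonneg)
  then have "(cmod (coord x k))\<^sup>2 \<le> (norm x)\<^sup>2"
    using sum_coord_le_norm order_trans by blast
  then show ?thesis
    by (rule power2_le_imp_le) simp
qed

instance ell2 :: complete_space
proof
  fix X :: "nat \<Rightarrow> ell2"
  assume X: "Cauchy X"
  have "convergent (\<lambda>m. coord (X m) k)" for k
  proof -
    have "Cauchy (\<lambda>m. coord (X m) k)"
    proof (rule CauchyI)
      fix e :: real assume "0 < e"
      then obtain M where M: "\<And>m n. m \<ge> M \<Longrightarrow> n \<ge> M \<Longrightarrow> norm (X m - X n) < e"
        using CauchyD[OF X] by blast
      have "norm (coord (X m) k - coord (X n) k) < e" if "m \<ge> M" "n \<ge> M" for m n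
        using le_less_trans[OF cmod_coord_le_norm[of "X m - X n" k] M[OF that]] by simp
      then show "\<exists>M. \<forall>m\<ge>M. \<forall>n\<ge>M. norm (coord (X m) k - coord (X n) k) < e"
        by blast
    qed
    then show ?thesis
      by (rule Cauchy_convergent)
  qed
  then obtain l where l: "\<And>k. (\<lambda>m. coord (X m) k) \<longlonglongrightarrow> l k"
    unfolding convergent_def by metis
  have tail: "\<exists>M. \<forall>m\<ge>M. \<forall>K. (\<Sum>k<K. (cmod (coord (X m) k - l k))\<^sup>2) \<le> e\<^sup>2" if "0 < e" for e
  proof -
    obtain M where M: "\<And>m n. m \<ge> M \<Longrightarrow> n \<ge> M \<Longrightarrow> norm (X m - X n) < e"
      using CauchyD[OF X \<open>0 < e\<close>] by blast
    have "(\<Sum>k<K. (cmod (coord (X m) k - l k))\<^sup>2) \<le> e\<^sup>2" if "m \<ge> M" for m K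
    proof (rule LIMSEQ_le_const2)
      show "(\<lambda>n. \<Sum>k<K. (cmod (coord (X m) k - coord (X n) k))\<^sup>2)
          \<longlonglongrightarrow> (\<Sum>k<K. (cmod (coord (X m) k - l k))\<^sup>2)"
        by (intro tendsto_intros l)
      have "(\<Sum>k<K. (cmod (coord (X m) k - coord (X n) k))\<^sup>2) \<le> e\<^sup>2" if "n \<ge> M" for n
      proof -
        have "(norm (X m - X n))\<^sup>2 \<le> e\<^sup>2"
          using M[OF \<open>m \<ge> M\<close> that] by (simp add: power_mono)
        then show ?thesis
          using order_trans[OF sum_coord_le_norm[where x = "X m - X n" and K = K]] by simp
      qed
      then show "\<exists>N. \<forall>n\<ge>N. (\<Sum>k<K. (cmod (coord (X m) k - coord (X n) k))\<^sup>2) \<le> e\<^sup>2"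
        by blast
    qed
    then show ?thesis by blast
  qed
  have diff_summable: "summable (\<lambda>k. (cmod (coord (X m) k - l k))\<^sup>2)"
    if "\<forall>K. (\<Sum>k<K. (cmod (coord (X m) k - l k))\<^sup>2) \<le> e" for m e
    by (rule summableI_nonneg_bounded[where x = e]) (use that in auto)
  obtain M where "\<forall>K. (\<Sum>k<K. (cmod (coord (X M) k - l k))\<^sup>2) \<le> 1\<^sup>2"
    using tail[of 1] by auto
  from ell2_add_summable[OF coord_summable[of "X M"] ell2_scale_summable[OF diff_summable[OF this], of "-1"]]
  have "summable (\<lambda>k. (cmod (l k))\<^sup>2)"
    by simp
  then have L: "coord (Abs_ell2 l) = l"
    by (rule coord_Abs)
  have "X \<longlonglongrightarrow> Abs_ell2 l"
  proof (rule LIMSEQ_I)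
    fix e :: real assume "0 < e"
    then obtain M where M: "\<And>m K. m \<ge> M \<Longrightarrow> (\<Sum>k<K. (cmod (coord (X m) k - l k))\<^sup>2) \<le> (e / 2)\<^sup>2"
      using tail[of "e / 2"] by auto
    have "norm (X m - Abs_ell2 l) < e" if "m \<ge> M" for m
    proof -
      have "(norm (X m - Abs_ell2 l))\<^sup>2 \<le> (e / 2)\<^sup>2"
        unfolding norm_ell2_sq
        by (rule suminf_le_const[OF coord_summable]) (use M[OF that] L in simp)
      then have "norm (X m - Abs_ell2 l) \<le> e / 2"
        by (rule power2_le_imp_le) (use \<open>0 < e\<close> in simp)
      then show ?thesis
        using \<open>0 < e\<close> by simp
    qed
    then show "\<exists>M. \<forall>m\<ge>M. norm (X m - Abs_ell2 l) < e"
      by blast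
  qed
  then show "convergent X"
    by (rule convergentI)
qed

instantiation ell2 :: chilbert_space
begin

definition "scaleC c x = Abs_ell2 (\<lambda>k. c * coord x k)"
definition "cinner x y = (\<Sum>k. cnj (coord x k) * coord y k)"

lemma coord_scaleC [simp]: "coord (c *\<^sub>C x) k = c * coord x k"
  unfolding scaleC_ell2_def by (subst coord_Abs) (rule ell2_scale_summable coord_summable refl)+

instance
proof
  fix x y z :: ell2 and c d :: complex and r :: real
  show "c *\<^sub>C (x + y) = c *\<^sub>C x + c *\<^sub>C y" "(c + d) *\<^sub>C x = c *\<^sub>C x + d *\<^sub>C x"
    "c *\<^sub>C d *\<^sub>C x = (c * d) *\<^sub>C x" "r *\<^sub>R x = complex_of_real r *\<^sub>C x"
    by (rule ell2_eqI; simp add: algebra_simps)+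
  have "cnj (cinner y x) = (\<Sum>k. cnj (cnj (coord y k) * coord x k))"
    unfolding cinner_ell2_def
    by (rule bounded_linear.suminf[OF bounded_linear_cnj ell2_cinner_summable])
  then show "cinner x y = cnj (cinner y x)"
    by (simp add: cinner_ell2_def mult.commute)
  show "cinner x (y + z) = cinner x y + cinner x z"
    unfolding cinner_ell2_def
    by (simp add: distrib_left suminf_add[OF ell2_cinner_summable ell2_cinner_summable, symmetric])
  show "cinner x (c *\<^sub>C y) = c * cinner x y"
    unfolding cinner_ell2_def
    by (simp add: mult.left_commute suminf_mult[OF ell2_cinner_summable])
  show "inner x y = Re (cinner x y)"
    by (simp add: inner_ell2_def cinner_ell2_def)
qed

end


section \<open>Unbounded operators and bases of representation\<close>

text \<open>An operator is identified with its graph; extension of operators is inclusion of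
  graphs, and the domain is \<^const>\<open>Domain\<close>.\<close>

definition linear_operator :: "('a::chilbert_space \<times> 'a) set \<Rightarrow> bool" where
  "linear_operator A \<longleftrightarrow> single_valued A \<and> (0, 0) \<in> A \<and>
     (\<forall>x y x' y'. (x, y) \<in> A \<longrightarrow> (x', y') \<in> A \<longrightarrow> (x + x', y + y') \<in> A) \<and>
     (\<forall>c x y. (x, y) \<in> A \<longrightarrow> (c *\<^sub>C x, c *\<^sub>C y) \<in> A)"

definition closed_operator :: "('a::chilbert_space \<times> 'a) set \<Rightarrow> bool" where
  "closed_operator A \<longleftrightarrow> linear_operator A \<and> closed A"

text \<open>Meaningful only for \<open>x\<close> in the domain of \<open>A\<close>.\<close>

definition op_apply :: "('a \<times> 'a) set \<Rightarrow> 'a \<Rightarrow> 'a" where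
  "op_apply A x = (THE y. (x, y) \<in> A)"

definition adjoint_op :: "('a::chilbert_space \<times> 'a) set \<Rightarrow> ('a \<times> 'a) set" where
  "adjoint_op A = {(y, z). \<forall>(x, w)\<in>A. cinner y w = cinner z x}"

definition selfadjoint :: "('a::chilbert_space \<times> 'a) set \<Rightarrow> bool" where
  "selfadjoint A \<longleftrightarrow> linear_operator A \<and> closure (Domain A) = UNIV \<and> adjoint_op A = A"

definition orthonormal_basis :: "(nat \<Rightarrow> 'a::chilbert_space) \<Rightarrow> bool" where
  "orthonormal_basis u \<longleftrightarrow>
     (\<forall>j k. cinner (u j) (u k) = (if j = k then 1 else 0)) \<and>
     (\<forall>x. (\<lambda>k. cinner (u k) x *\<^sub>C u k) sums x)"

definition basis_of_representation ::
  "('a::chilbert_space \<times> 'a) set \<Rightarrow> (nat \<Rightarrow> 'a) \<Rightarrow> bool" where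
  "basis_of_representation A u \<longleftrightarrow> closed_operator A \<and> orthonormal_basis u \<and>
     (\<forall>k. u k \<in> Domain A) \<and>
     (\<forall>B. closed_operator B \<and> (\<forall>k. u k \<in> Domain B \<and> op_apply B (u k) = op_apply A (u k))
        \<longrightarrow> A \<subseteq> B)"

definition matrix_representation ::
  "('a::chilbert_space \<times> 'a) set \<Rightarrow> (nat \<Rightarrow> 'a) \<Rightarrow> nat \<Rightarrow> nat \<Rightarrow> complex" where
  "matrix_representation A u k j = cinner (u k) (op_apply A (u j))"


section \<open>Jacobi matrices and Jacobi operators\<close>

definition jacobi_matrix :: "(nat \<Rightarrow> nat \<Rightarrow> complex) \<Rightarrow> bool" where
  "jacobi_matrix M \<longleftrightarrow> (\<exists>q b :: nat \<Rightarrow> real. (\<forall>k. 0 < b k) \<and>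
     (\<forall>k j. M k j =
        (if j = k then complex_of_real (q k)
         else if j = k + 1 then complex_of_real (b k)
         else if k = j + 1 then complex_of_real (b j)
         else 0)))"

text \<open>The image of a finitely supported sequence is again finitely supported, so every
  finitely supported element belongs to the domain of this operator.\<close>

definition jacobi_finite :: "(nat \<Rightarrow> real) \<Rightarrow> (nat \<Rightarrow> real) \<Rightarrow> (ell2 \<times> ell2) set" where
  "jacobi_finite q b = {(\<phi>, \<psi>). finite {k. coord \<phi> k \<noteq> 0} \<and>
     (\<forall>k. coord \<psi> k =
        (if k = 0 then 0 else complex_of_real (b (k - 1)) * coord \<phi> (k - 1))
        + complex_of_real (q k) * coord \<phi> k
        + complex_of_real (b k) * coord \<phi> (k + 1))}"

definition jacobi_operator :: "(ell2 \<times> ell2) set \<Rightarrow> bool" where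
  "jacobi_operator J \<longleftrightarrow>
     (\<exists>q b. (\<forall>k. 0 < b k) \<and> J = closure (jacobi_finite q b))"

definition jacobi_bases :: "('a::chilbert_space \<times> 'a) set \<Rightarrow> (nat \<Rightarrow> 'a) set" where
  "jacobi_bases J =
     {u. basis_of_representation J u \<and> jacobi_matrix (matrix_representation J u)}"

text \<open>
  Bases are identified when one arises from the other by multiplying every element by
  one and the same unimodular scalar. Over the real scalars this is reflection, that is,
  multiplication by \<open>1\<close> or \<open>-1\<close>. Over the complex scalars every unimodular \<open>c\<close> has to be
  admitted: \<open>c u\<^sub>k\<close> is a basis of representation with the same matrix whenever \<open>u\<^sub>k\<close> is.
  Identification up to \<open>-1\<close> alone would thus never leave a single basis, not even for a
  nonselfadjoint Jacobi operator.
\<close>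

definition equal_mod_phase ::
  "(nat \<Rightarrow> 'a::chilbert_space) \<Rightarrow> (nat \<Rightarrow> 'a) \<Rightarrow> bool" where
  "equal_mod_phase u v \<longleftrightarrow> (\<exists>c. cmod c = 1 \<and> (\<forall>k. v k = c *\<^sub>C u k))"

end

theory Submission
  imports Defs "HOL-Complex_Analysis.Complex_Analysis"
begin

text \<open>
  Write \<open>P z\<close> for the formal eigenvector of the Jacobi matrix at \<open>z\<close>, normalized to have first
  entry 1, and recall that the adjoint of \<open>J\<close> is the maximal operator of the matrix.

  If \<open>J\<close> is selfadjoint, put \<open>g = (J - \<i>)\<^sup>-\<^sup>1 \<delta>\<^sub>0\<close>. Then \<open>J\<close> acts on \<open>g, \<delta>\<^sub>0, \<delta>\<^sub>1, \<dots>\<close> by a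
  Hessenberg matrix with positive subdiagonal, so Gram--Schmidt turns this sequence into a Jacobi
  basis; it differs from the canonical one because \<open>g\<close> does not have finite support.

  If \<open>J\<close> is not selfadjoint, all formal eigenvectors are square summable, and variation of
  constants bounds them by a function of minimal exponential type in \<open>z\<close>. Let \<open>v\<close> be any Jacobi
  basis. The entire function \<open>G z = \<langle>v\<^sub>0, P z\<rangle>\<close> has no zeros: a zero would propagate through the
  three-term recurrence of \<open>v\<close> and make \<open>P z\<close> orthogonal to every \<open>v\<^sub>k\<close>. A zero-free entire function
  of minimal exponential type is constant, so \<open>v\<^sub>0\<close> minus a multiple of \<open>\<delta>\<^sub>0\<close> is orthogonal to all
  \<open>P z\<close>. These vectors are total, hence \<open>v\<^sub>0\<close> is a multiple of \<open>\<delta>\<^sub>0\<close>, and then so is each \<open>v\<^sub>k\<close> of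
  \<open>\<delta>\<^sub>k\<close>.
\<close>

section \<open>Complex Hilbert spaces\<close>

text \<open>The unit law is not an axiom of the class; it comes from real scaling by 1. The
  interpretation provides spans and subspaces over the complex field.\<close>

global_interpretation cvec: vector_space "scaleC :: complex \<Rightarrow> 'a \<Rightarrow> 'a::chilbert_space"
proof
  show "1 *\<^sub>C x = x" for x :: 'a
    using scaleR_eq_scaleC[of 1 x] by simp
qed (rule scaleC_add_right scaleC_add_left scaleC_scaleC)+

section \<open>Algebra and continuity of the complex inner product\<close>

lemma cinner_add_left: "cinner (x + y) z = cinner x z + cinner y z"
  by (metis cinner_add_right cinner_commute complex_cnj_add)

lemma cinner_scaleC_left: "cinner (c *\<^sub>C x) y = cnj c * cinner x y"
  by (metis cinner_commute cinner_scaleC_right complex_cnj_mult)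

lemma cinner_zero_right [simp]: "cinner x 0 = 0"
  using cinner_add_right[of x 0 0] by simp

lemma cinner_zero_left [simp]: "cinner 0 x = 0"
  by (metis cinner_commute cinner_zero_right complex_cnj_zero)

lemma cinner_minus_right: "cinner x (- y) = - cinner x y"
  using cinner_add_right[of x y "- y"] by (simp add: add_eq_0_iff)

lemma cinner_diff_right: "cinner x (y - z) = cinner x y - cinner x z"
  using cinner_add_right[of x y "- z"] by (simp add: cinner_minus_right)

lemma cinner_diff_left: "cinner (x - y) z = cinner x z - cinner y z"
  by (metis cinner_commute cinner_diff_right complex_cnj_diff)

lemma cinner_sum_right: "cinner x (sum f A) = (\<Sum>a\<in>A. cinner x (f a))"
  by (induction A rule: infinite_finite_induct) (simp_all add: cinner_add_right)

lemma cinner_self: "cinner x x = complex_of_real ((norm x)\<^sup>2)"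
proof -
  have "Im (cinner x x) = 0"
    using arg_cong[OF cinner_commute[of x x], of Im] by simp
  moreover have "Re (cinner x x) = (norm x)\<^sup>2"
    by (metis inner_eq_Re_cinner power2_norm_eq_inner)
  ultimately show ?thesis
    by (simp add: complex_eq_iff)
qed

lemma cinner_self_eq_0_iff: "cinner x x = 0 \<longleftrightarrow> x = 0"
  by (simp add: cinner_self)

lemma norm_scaleC: "norm (c *\<^sub>C x) = cmod c * norm x"
proof -
  have "complex_of_real ((norm (c *\<^sub>C x))\<^sup>2) = complex_of_real ((cmod c * norm x)\<^sup>2)"
    unfolding cinner_self[symmetric] cinner_scaleC_left cinner_scaleC_right power_mult_distrib of_real_mult
      complex_norm_square
    by simp
  then show ?thesis
    by (smt (verit) mult_nonneg_nonneg norm_ge_zero of_real_eq_iff power2_eq_iff_nonneg)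
qed

text \<open>Rotating \<open>y\<close> by a phase makes the inner product real and nonnegative, so
  the real Cauchy-Schwarz inequality applies.\<close>

lemma cmod_cinner_le: "cmod (cinner x y) \<le> norm x * norm y"
proof (cases "cinner x y = 0")
  case False
  define c where "c = cnj (cinner x y) / cmod (cinner x y)"
  have c: "cmod c = 1"
    using False by (simp add: c_def norm_divide)
  have "cmod (cinner x y) = Re (cinner x (c *\<^sub>C y))"
    using False by (simp add: c_def cinner_scaleC_right mult.commute[of "cnj _"] complex_norm_square[symmetric]
        power2_eq_square flip: of_real_mult)
  also have "\<dots> \<le> norm x * norm (c *\<^sub>C y)"
    unfolding inner_eq_Re_cinner[symmetric] by (rule norm_cauchy_schwarz)
  finally show ?thesis
    by (simp add: norm_scaleC c)
qed simp

lemma tendsto_cinner: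
  assumes "(f \<longlongrightarrow> a) F" "(g \<longlongrightarrow> b) F"
  shows "((\<lambda>x. cinner (f x) (g x)) \<longlongrightarrow> cinner a b) F"
proof -
  have *: "cinner (f x) (g x) - cinner a b = cinner (f x - a) (g x) + cinner a (g x - b)" for x
    by (simp add: cinner_diff_left cinner_diff_right)
  have "((\<lambda>x. norm (f x - a) * norm (g x) + norm a * norm (g x - b)) \<longlongrightarrow> 0 * norm b + norm a * 0) F"
    by (intro tendsto_intros tendsto_norm_zero LIM_zero assms)
  then have lim: "((\<lambda>x. norm (f x - a) * norm (g x) + norm a * norm (g x - b)) \<longlongrightarrow> 0) F"
    by simp
  have "((\<lambda>x. cinner (f x) (g x) - cinner a b) \<longlongrightarrow> 0) F"
  proof (rule Lim_null_comparison[OF always_eventually lim], rule allI)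
    fix x
    show "cmod (cinner (f x) (g x) - cinner a b)
        \<le> norm (f x - a) * norm (g x) + norm a * norm (g x - b)"
      unfolding * by (intro norm_triangle_le add_mono cmod_cinner_le)
  qed
  then show ?thesis
    by (rule LIM_zero_cancel)
qed

lemma tendsto_scaleC:
  fixes a :: "'a::chilbert_space"
  assumes "(f \<longlongrightarrow> a) F"
  shows "((\<lambda>x. c *\<^sub>C f x) \<longlongrightarrow> c *\<^sub>C a) F"
proof -
  have "((\<lambda>x. cmod c * norm (f x - a)) \<longlongrightarrow> cmod c * 0) F"
    by (intro tendsto_intros tendsto_norm_zero LIM_zero assms)
  then have "((\<lambda>x. c *\<^sub>C f x - c *\<^sub>C a) \<longlongrightarrow> 0) F"
    by (subst tendsto_norm_zero_iff[symmetric])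
      (simp add: cvec.scale_right_diff_distrib[symmetric] norm_scaleC)
  then show ?thesis
    by (rule LIM_zero_cancel)
qed

section \<open>Orthogonal projection onto a closed subspace\<close>

lemma parallelogram_law: "(norm (x + y))\<^sup>2 + (norm (x - y))\<^sup>2 = 2 * (norm x)\<^sup>2 + 2 * (norm y)\<^sup>2"
  for x y :: "'a::real_inner"
  by (simp add: power2_norm_eq_inner algebra_simps inner_commute)

text \<open>A minimizing sequence for the distance to \<open>x\<close> is Cauchy by the
  parallelogram law. Its limit is the foot of the perpendicular, since no step along an element of
  \<open>S\<close> can shorten the distance.\<close>

lemma closed_subspace_projection:
  fixes S :: "'a::chilbert_space set"
  assumes S: "cvec.subspace S" and cl: "closed S"
  obtains s where "s \<in> S" "\<And>t. t \<in> S \<Longrightarrow> cinner t (x - s) = 0"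
proof -
  define d where "d = Inf ((\<lambda>s. (norm (x - s))\<^sup>2) ` S)"
  have bdd: "bdd_below ((\<lambda>s. (norm (x - s))\<^sup>2) ` S)"
    by (rule bdd_belowI[of _ 0]) auto
  have d_le: "d \<le> (norm (x - s))\<^sup>2" if "s \<in> S" for s
    unfolding d_def using bdd that by (intro cInf_lower) auto
  have "\<exists>s\<in>S. (norm (x - s))\<^sup>2 < d + 1 / Suc n" for n
  proof -
    have "Inf ((\<lambda>s. (norm (x - s))\<^sup>2) ` S) < d + 1 / Suc n"
      unfolding d_def by simp
    then show ?thesis
      using cvec.subspace_0[OF S] by (subst (asm) cInf_less_iff) (auto simp: bdd)
  qed
  then obtain s where s: "\<And>n. s n \<in> S" "\<And>n. (norm (x - s n))\<^sup>2 < d + 1 / Suc n"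
    by metis
  \<comment> \<open>The midpoint of \<open>s m\<close> and \<open>s n\<close> lies in
    \<open>S\<close>, so its squared distance to \<open>x\<close> is at least \<open>d\<close>; the
    parallelogram law turns this into a bound on the difference.\<close>
  have half: "(norm (s m - s n))\<^sup>2 \<le> 2 / Suc m + 2 / Suc n" for m n
  proof -
    have "(1/2) *\<^sub>R (s m + s n) \<in> S"
      unfolding scaleR_eq_scaleC by (intro cvec.subspace_scale[OF S] cvec.subspace_add[OF S] s)
    from d_le[OF this] have "4 * d \<le> 4 * (norm (x - (1/2) *\<^sub>R (s m + s n)))\<^sup>2"
      by simp
    also have "\<dots> = (norm (2 *\<^sub>R (x - (1/2) *\<^sub>R (s m + s n))))\<^sup>2"
      unfolding norm_scaleR by simp
    also have "2 *\<^sub>R (x - (1/2) *\<^sub>R (s m + s n)) = (x - s m) + (x - s n)"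
      by (simp add: algebra_simps scaleR_2)
    finally have "4 * d \<le> (norm ((x - s m) + (x - s n)))\<^sup>2" .
    moreover have "(norm ((x - s m) + (x - s n)))\<^sup>2 + (norm ((x - s m) - (x - s n)))\<^sup>2
        = 2 * (norm (x - s m))\<^sup>2 + 2 * (norm (x - s n))\<^sup>2"
      by (rule parallelogram_law)
    moreover have "(norm ((x - s m) - (x - s n)))\<^sup>2 = (norm (s m - s n))\<^sup>2"
      by (simp add: norm_minus_commute)
    ultimately show ?thesis
      using s(2)[of m] s(2)[of n] by simp
  qed
  have "Cauchy s"
  proof (rule CauchyI)
    fix e :: real assume "0 < e"
    obtain N where N: "4 / e\<^sup>2 < real (Suc N)"
      using reals_Archimedean2 less_trans of_nat_less_iff lessI by metis
    have "norm (s m - s n) < e" if "N \<le> m" "N \<le> n" for m n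
    proof -
      have "2 / Suc m \<le> 2 / Suc N" "2 / Suc n \<le> 2 / Suc N"
        using that by (auto intro!: divide_left_mono)
      then have "(norm (s m - s n))\<^sup>2 \<le> 4 / Suc N"
        using half[of m n] by simp
      also have "\<dots> < e\<^sup>2"
        using N \<open>0 < e\<close> by (simp add: field_simps)
      finally show ?thesis
        using \<open>0 < e\<close> by (meson less_eq_real_def power_less_imp_less_base)
    qed
    then show "\<exists>M. \<forall>m\<ge>M. \<forall>n\<ge>M. norm (s m - s n) < e"
      by blast
  qed
  then obtain p where p: "s \<longlonglongrightarrow> p"
    using Cauchy_convergent convergent_def by blast
  have "p \<in> S"
    using closed_sequentially[OF cl _ p] s by blast
  have "(norm (x - p))\<^sup>2 \<le> d + 0"
  proof (rule LIMSEQ_le)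
    show "(\<lambda>n. (norm (x - s n))\<^sup>2) \<longlonglongrightarrow> (norm (x - p))\<^sup>2"
      by (intro tendsto_intros p)
    show "(\<lambda>n. d + 1 / Suc n) \<longlonglongrightarrow> d + 0"
      by (intro tendsto_intros) (rule LIMSEQ_Suc[OF lim_1_over_n])
  qed (use s(2) less_imp_le in blast)
  then have min: "(norm (x - p))\<^sup>2 \<le> (norm (x - t))\<^sup>2" if "t \<in> S" for t
    using d_le[OF that] by linarith
  have "cinner t (x - p) = 0" if "t \<in> S" for t
  proof (cases "t = 0")
    case False
    \<comment> \<open>Subtracting the component of \<open>x - p\<close> along \<open>t\<close>
      lowers the squared distance by exactly (|c| |t|)^2, so minimality forces c = 0.\<close>
    define c where "c = cinner t (x - p) / (norm t)\<^sup>2"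
    have "p + c *\<^sub>C t \<in> S"
      using \<open>p \<in> S\<close> that S by (intro cvec.subspace_add cvec.subspace_scale)
    from min[OF this] have "(norm (x - p))\<^sup>2 \<le> (norm ((x - p) - c *\<^sub>C t))\<^sup>2"
      by (simp add: diff_diff_eq)
    moreover have "complex_of_real ((norm ((x - p) - c *\<^sub>C t))\<^sup>2)
        = complex_of_real ((norm (x - p))\<^sup>2 - (cmod c * norm t)\<^sup>2)"
    proof -
      have c1: "cinner t (x - p) = c * (norm t)\<^sup>2"
        using False by (simp add: c_def)
      then have c2: "cinner (x - p) t = cnj c * (norm t)\<^sup>2"
        by (metis cinner_commute complex_cnj_complex_of_real complex_cnj_mult)
      define e where "e = x - p"
      have "cinner (e - c *\<^sub>C t) (e - c *\<^sub>C t)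
          = cinner e e - c * cinner e t - cnj c * cinner t e + cnj c * c * cinner t t"
        by (simp add: cinner_diff_left cinner_diff_right
            cinner_scaleC_left cinner_scaleC_right algebra_simps)
      then show ?thesis
        unfolding e_def
        unfolding c1 c2 cinner_self
        by (simp add: power_mult_distrib complex_norm_square flip: of_real_power)
    qed
    ultimately have "(cmod c * norm t)\<^sup>2 \<le> 0"
      unfolding of_real_eq_iff by simp
    then have "c = 0"
      using False by simp
    then show ?thesis
      using False by (simp add: c_def)
  qed simp
  then show thesis
    using that \<open>p \<in> S\<close> by blast
qed


section \<open>Jacobi operators\<close>

lemma coord_sum: "coord (sum f A) k = (\<Sum>a\<in>A. coord (f a) k)"
  by (induction A rule: infinite_finite_induct) simp_all

definition delta :: "nat \<Rightarrow> ell2" where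
  "delta k = Abs_ell2 (\<lambda>j. if j = k then 1 else 0)"

lemma coord_delta [simp]: "coord (delta k) j = (if j = k then 1 else 0)"
proof -
  have "summable (\<lambda>j. (cmod (if j = k then 1 else 0))\<^sup>2)"
    by (rule summable_finite[of "{k}"]) auto
  then show ?thesis
    by (simp add: delta_def coord_Abs)
qed

lemma cinner_delta: "cinner (delta k) x = coord x k"
proof -
  have "(\<Sum>j. cnj (coord (delta k) j) * coord x j) = (\<Sum>j\<in>{k}. cnj (coord (delta k) j) * coord x j)"
    by (rule suminf_finite) auto
  then show ?thesis
    by (simp add: cinner_ell2_def)
qed

lemma norm_delta [simp]: "norm (delta k) = 1"
proof -
  have "complex_of_real ((norm (delta k))\<^sup>2) = 1"
    unfolding cinner_self[symmetric] by (simp add: cinner_delta)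
  then have "(norm (delta k))\<^sup>2 = 1\<^sup>2"
    unfolding of_real_eq_1_iff by simp
  then show ?thesis
    unfolding power2_eq_iff_nonneg[OF norm_ge_zero zero_le_one] .
qed

lemma tendsto_coord: "(f \<longlongrightarrow> a) F \<Longrightarrow> ((\<lambda>x. coord (f x) k) \<longlongrightarrow> coord a k) F"
  unfolding cinner_delta[symmetric] by (intro tendsto_cinner tendsto_const)

lemma coord_partial_sum: "coord (\<Sum>k<n. coord x k *\<^sub>C delta k) j = (if j < n then coord x j else 0)"
  by (simp add: coord_sum if_distrib[of "\<lambda>c. _ * c"] cong: if_cong)

text \<open>Subtracting the first n terms deletes the first n coordinates, so the squared error is a
  tail of the convergent series for the squared norm.\<close>

lemma delta_expansion: "(\<lambda>k. coord x k *\<^sub>C delta k) sums x"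
proof -
  have *: "(norm (x - (\<Sum>k<n. coord x k *\<^sub>C delta k)))\<^sup>2 = (norm x)\<^sup>2 - (\<Sum>k<n. (cmod (coord x k))\<^sup>2)" for n
  proof -
    have "summable (\<lambda>k. if k < n then (cmod (coord x k))\<^sup>2 else 0)"
      by (rule summable_finite[of "{..<n}"]) auto
    moreover have "(\<Sum>k. if k < n then (cmod (coord x k))\<^sup>2 else 0) = (\<Sum>k<n. (cmod (coord x k))\<^sup>2)"
      by (subst suminf_finite[of "{..<n}"]) auto
    moreover have "(cmod (coord (x - (\<Sum>k<n. coord x k *\<^sub>C delta k)) k))\<^sup>2
        = (cmod (coord x k))\<^sup>2 - (if k < n then (cmod (coord x k))\<^sup>2 else 0)" for k
      by (simp add: coord_partial_sum)
    ultimately show ?thesis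
      by (simp add: norm_ell2_sq suminf_diff[OF coord_summable, symmetric])
  qed
  have "(\<lambda>n. (norm x)\<^sup>2 - (\<Sum>k<n. (cmod (coord x k))\<^sup>2)) \<longlonglongrightarrow> (norm x)\<^sup>2 - (norm x)\<^sup>2"
    unfolding norm_ell2_sq by (intro tendsto_intros summable_LIMSEQ coord_summable)
  then have "(\<lambda>n. sqrt ((norm (x - (\<Sum>k<n. coord x k *\<^sub>C delta k)))\<^sup>2)) \<longlonglongrightarrow> sqrt 0"
    unfolding * by (intro tendsto_intros) simp
  then have "(\<lambda>n. x - (\<Sum>k<n. coord x k *\<^sub>C delta k)) \<longlonglongrightarrow> 0"
    by (subst tendsto_norm_zero_iff[symmetric]) simp
  then have "(\<lambda>n. x - (x - (\<Sum>k<n. coord x k *\<^sub>C delta k))) \<longlonglongrightarrow> x - 0"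
    by (intro tendsto_intros)
  then show ?thesis
    by (simp add: sums_def)
qed

lemma orthonormal_basis_delta: "orthonormal_basis delta"
  by (auto simp: orthonormal_basis_def cinner_delta delta_expansion)

section \<open>Linear operators as graphs\<close>

lemma linear_operatorD:
  assumes "linear_operator A"
  shows "(x, y) \<in> A \<Longrightarrow> (x, y') \<in> A \<Longrightarrow> y = y'" "(0, 0) \<in> A"
    "(x, y) \<in> A \<Longrightarrow> (x', y') \<in> A \<Longrightarrow> (x + x', y + y') \<in> A"
    "(x, y) \<in> A \<Longrightarrow> (c *\<^sub>C x, c *\<^sub>C y) \<in> A"
    "(x, y) \<in> A \<Longrightarrow> (x', y') \<in> A \<Longrightarrow> (x - x', y - y') \<in> A"
proof -
  show "(x, y) \<in> A \<Longrightarrow> (x, y') \<in> A \<Longrightarrow> y = y'" "(0, 0) \<in> A"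
    "(x, y) \<in> A \<Longrightarrow> (x', y') \<in> A \<Longrightarrow> (x + x', y + y') \<in> A"
    "(x, y) \<in> A \<Longrightarrow> (c *\<^sub>C x, c *\<^sub>C y) \<in> A" for x y x' y' c
    using assms by (auto simp: linear_operator_def single_valued_def)
  from this(3)[of x y "(-1) *\<^sub>C x'" "(-1) *\<^sub>C y'"] this(4)[of x' y' "-1"]
  show "(x, y) \<in> A \<Longrightarrow> (x', y') \<in> A \<Longrightarrow> (x - x', y - y') \<in> A"
    by (simp add: cvec.scale_minus_left)
qed

lemma op_apply_eq:
  assumes "linear_operator A" "(x, y) \<in> A"
  shows "op_apply A x = y"
  unfolding op_apply_def using assms linear_operatorD(1) by blast

lemma op_apply_mem:
  assumes "linear_operator A" "x \<in> Domain A"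
  shows "(x, op_apply A x) \<in> A"
  using assms op_apply_eq by blast

lemma subspace_Domain:
  assumes "linear_operator A"
  shows "cvec.subspace (Domain A)"
  using linear_operatorD(2-4)[OF assms] unfolding cvec.subspace_def Domain_iff by blast

text \<open>The domain of the intersection is the subspace on which the two operators agree;
  agreement on a basis thereby extends to its span.\<close>

lemma linear_operator_Int:
  assumes "linear_operator A" "linear_operator B"
  shows "linear_operator (A \<inter> B)"
  unfolding linear_operator_def single_valued_def
  using linear_operatorD(1-4)[OF assms(1)] linear_operatorD(2-4)[OF assms(2)] by auto

section \<open>The Jacobi operator and the maximal operator of its matrix\<close>

locale jacobi =
  fixes q b :: "nat \<Rightarrow> real"
  assumes b_pos: "0 < b k"
begin

lemma b_nonzero [simp]: "b k \<noteq> 0"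
  using b_pos[of k] by simp

text \<open>The matrix acts on arbitrary sequences, because formal eigenvectors need not be square
  summable.\<close>

definition L :: "(nat \<Rightarrow> complex) \<Rightarrow> nat \<Rightarrow> complex" where
  "L \<phi> k = (if k = 0 then 0 else complex_of_real (b (k - 1)) * \<phi> (k - 1))
     + complex_of_real (q k) * \<phi> k + complex_of_real (b k) * \<phi> (k + 1)"

definition J :: "(ell2 \<times> ell2) set" where
  "J = closure (jacobi_finite q b)"

definition Jmax :: "(ell2 \<times> ell2) set" where
  "Jmax = {(y, w). \<forall>k. coord w k = L (coord y) k}"

definition Jdelta :: "nat \<Rightarrow> ell2" where
  "Jdelta k = (if k = 0 then 0 else complex_of_real (b (k - 1)) *\<^sub>C delta (k - 1))
     + complex_of_real (q k) *\<^sub>C delta k + complex_of_real (b k) *\<^sub>C delta (Suc k)"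

lemma JmaxD: "(y, w) \<in> Jmax \<Longrightarrow> coord w k = L (coord y) k"
  by (simp add: Jmax_def)

lemma jacobi_finite_iff:
  "(x, v) \<in> jacobi_finite q b \<longleftrightarrow> finite {k. coord x k \<noteq> 0} \<and> (x, v) \<in> Jmax"
  by (simp add: jacobi_finite_def Jmax_def L_def)

lemma delta_Jdelta_finite: "(delta k, Jdelta k) \<in> jacobi_finite q b"
  unfolding jacobi_finite_iff Jmax_def L_def Jdelta_def
  by (auto intro: finite_subset[of _ "{k}"])

lemma linear_Jmax: "linear_operator Jmax"
  unfolding linear_operator_def
proof (intro conjI)
  show "single_valued Jmax"
    unfolding single_valued_def by (metis JmaxD ell2_eqI)
qed (auto simp: Jmax_def L_def algebra_simps)

lemma linear_jacobi_finite: "linear_operator (jacobi_finite q b)"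
proof -
  have "finite {k. coord (x + y) k \<noteq> 0}" if "finite {k. coord x k \<noteq> 0}" "finite {k. coord y k \<noteq> 0}" for x y
    by (rule finite_subset[OF _ finite_UnI[OF that]]) auto
  moreover have "finite {k. coord (c *\<^sub>C x) k \<noteq> 0}" if "finite {k. coord x k \<noteq> 0}" for c x
    by (rule finite_subset[OF _ that]) auto
  ultimately show ?thesis
    using linear_Jmax unfolding linear_operator_def single_valued_def jacobi_finite_iff
    by (auto simp del: coord_add coord_scaleC)
qed

text \<open>Each row involves at most three coordinates, and coordinates are continuous.\<close>

lemma closed_Jmax: "closed Jmax"
proof -
  have "(x, v) \<in> Jmax" if XV: "\<And>n. XV n \<in> Jmax" and lim: "XV \<longlonglongrightarrow> (x, v)" for XV x v
  proof -
    have X: "(\<lambda>n. fst (XV n)) \<longlonglongrightarrow> x" and V: "(\<lambda>n. snd (XV n)) \<longlonglongrightarrow> v"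
      using tendsto_fst[OF lim] tendsto_snd[OF lim] by simp_all
    have "coord v k = L (coord x) k" for k
    proof (rule LIMSEQ_unique)
      show "(\<lambda>n. coord (snd (XV n)) k) \<longlonglongrightarrow> coord v k"
        by (rule tendsto_coord[OF V])
      have "(\<lambda>n. L (coord (fst (XV n))) k) \<longlonglongrightarrow> L (coord x) k"
        unfolding L_def by (cases "k = 0") (auto intro!: tendsto_intros tendsto_coord[OF X])
      moreover have "L (coord (fst (XV n))) k = coord (snd (XV n)) k" for n
        using XV[of n] by (simp add: Jmax_def case_prod_beta)
      ultimately show "(\<lambda>n. coord (snd (XV n)) k) \<longlonglongrightarrow> L (coord x) k"
        by simp
    qed
    then show ?thesis
      by (simp add: Jmax_def)
  qed
  then show ?thesis
    unfolding closed_sequential_limits by (metis surj_pair)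
qed

lemma J_subset_Jmax: "J \<subseteq> Jmax"
  unfolding J_def by (rule closure_minimal) (auto simp: jacobi_finite_iff closed_Jmax)

lemma J_sequentialE:
  assumes "(x, v) \<in> J"
  obtains X V where "\<And>n. (X n, V n) \<in> jacobi_finite q b" "X \<longlonglongrightarrow> x" "V \<longlonglongrightarrow> v"
proof -
  from assms obtain XV where XV: "\<And>n. XV n \<in> jacobi_finite q b" and lim: "XV \<longlonglongrightarrow> (x, v)"
    unfolding J_def closure_sequential by blast
  show thesis
    by (rule that[of "\<lambda>n. fst (XV n)" "\<lambda>n. snd (XV n)"])
      (use XV tendsto_fst[OF lim] tendsto_snd[OF lim] in simp_all)
qed

lemma J_sequentialI:
  assumes "\<And>n. (X n, V n) \<in> jacobi_finite q b" "X \<longlonglongrightarrow> x" "V \<longlonglongrightarrow> v"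
  shows "(x, v) \<in> J"
  unfolding J_def closure_sequential
  by (rule exI[of _ "\<lambda>n. (X n, V n)"]) (simp add: assms tendsto_Pair)

lemma linear_J: "linear_operator J"
  unfolding linear_operator_def
proof (intro conjI allI impI)
  \<comment> \<open>The closure of a graph may fail to be a graph; this one stays inside the
    single-valued \<open>Jmax\<close>.\<close>
  show "single_valued J"
    unfolding single_valued_def using J_subset_Jmax
    by (metis JmaxD ell2_eqI subsetD)
  show "(0, 0) \<in> J"
    unfolding J_def using linear_operatorD(2)[OF linear_jacobi_finite] closure_subset by blast
next
  fix x v x' v' assume "(x, v) \<in> J" "(x', v') \<in> J"
  from J_sequentialE[OF this(1)] J_sequentialE[OF this(2)]
  obtain X V X' V' where 1: "\<And>n. (X n, V n) \<in> jacobi_finite q b" "X \<longlonglongrightarrow> x" "V \<longlonglongrightarrow> v"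
    and 2: "\<And>n. (X' n, V' n) \<in> jacobi_finite q b" "X' \<longlonglongrightarrow> x'" "V' \<longlonglongrightarrow> v'"
    by metis
  show "(x + x', v + v') \<in> J"
    by (rule J_sequentialI[of "\<lambda>n. X n + X' n" "\<lambda>n. V n + V' n"])
      (intro linear_operatorD(3)[OF linear_jacobi_finite] tendsto_intros 1 2)+
next
  fix c x v assume "(x, v) \<in> J"
  from J_sequentialE[OF this]
  obtain X V where 1: "\<And>n. (X n, V n) \<in> jacobi_finite q b" "X \<longlonglongrightarrow> x" "V \<longlonglongrightarrow> v"
    by metis
  show "(c *\<^sub>C x, c *\<^sub>C v) \<in> J"
    by (rule J_sequentialI[of "\<lambda>n. c *\<^sub>C X n" "\<lambda>n. c *\<^sub>C V n"])
      (intro linear_operatorD(4)[OF linear_jacobi_finite] tendsto_scaleC 1)+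
qed

lemma closed_J: "closed J"
  by (simp add: J_def)

lemma closed_operator_J: "closed_operator J"
  by (simp add: closed_operator_def linear_J closed_J)

lemma delta_Jdelta: "(delta k, Jdelta k) \<in> J"
  unfolding J_def using delta_Jdelta_finite closure_subset by blast

lemma partial_sum_in_Domain: "(\<Sum>k<n. coord x k *\<^sub>C delta k) \<in> Domain J"
  by (intro cvec.subspace_sum cvec.subspace_scale subspace_Domain linear_J DomainI[OF delta_Jdelta])

lemma closure_Domain_J: "closure (Domain J) = UNIV"
proof -
  have "x \<in> closure (Domain J)" for x
    unfolding closure_sequential
    using delta_expansion[of x, unfolded sums_def] partial_sum_in_Domain[where x = x]
    by (intro exI[of _ "\<lambda>n. \<Sum>k<n. coord x k *\<^sub>C delta k"]) simp
  then show ?thesis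
    by blast
qed

section \<open>Green's identity and the adjoint\<close>

text \<open>The boundary term is the Wronskian of the two sequences.\<close>

lemma summation_by_parts:
  "(\<Sum>k<Suc n. cnj (y k) * L x k) - (\<Sum>k<Suc n. cnj (L y k) * x k)
    = b n * (cnj (y n) * x (Suc n) - cnj (y (Suc n)) * x n)"
proof (induction n)
  case (Suc n)
  then show ?case
    unfolding sum.lessThan_Suc[of _ "Suc n"] by (simp add: L_def[of _ "Suc n"] algebra_simps)
qed (simp add: L_def algebra_simps)

text \<open>Beyond the support of \<open>x\<close> the boundary term of
  \<open>summation_by_parts\<close> vanishes, so the partial sums of the two inner products
  eventually coincide.\<close>

lemma green_finite:
  assumes yw: "(y, w) \<in> Jmax" and xv: "(x, v) \<in> jacobi_finite q b"
  shows "cinner y v = cinner w x"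
proof (rule LIMSEQ_unique)
  obtain N where N: "\<And>k. N \<le> k \<Longrightarrow> coord x k = 0"
    using xv unfolding jacobi_finite_iff finite_nat_set_iff_bounded
    by (metis (mono_tags, lifting) linorder_not_less mem_Collect_eq)
  have v: "coord v = L (coord x)" and w: "coord w = L (coord y)"
    using xv yw by (auto simp: jacobi_finite_iff Jmax_def)
  show "(\<lambda>n. \<Sum>k<n. cnj (coord y k) * coord v k) \<longlonglongrightarrow> cinner y v"
    unfolding cinner_ell2_def by (rule summable_LIMSEQ[OF ell2_cinner_summable])
  have "(\<lambda>n. \<Sum>k<n. cnj (coord w k) * coord x k) \<longlonglongrightarrow> cinner w x"
    unfolding cinner_ell2_def by (rule summable_LIMSEQ[OF ell2_cinner_summable])
  moreover have "\<forall>\<^sub>F n in sequentially.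
      (\<Sum>k<n. cnj (coord w k) * coord x k) = (\<Sum>k<n. cnj (coord y k) * coord v k)"
    \<comment> \<open>For n = m + 1 the boundary term contains entries m and m + 1 of
      \<open>x\<close>; both are zero once N \<le> m.\<close>
    using eventually_ge_at_top[of "Suc N"]
  proof eventually_elim
    case (elim n)
    then obtain m where m: "n = Suc m" "N \<le> m"
      by (metis Suc_le_D Suc_le_mono)
    show ?case
      unfolding v w m using summation_by_parts[of "coord y" "coord x" m] N m by simp
  qed
  ultimately show "(\<lambda>n. \<Sum>k<n. cnj (coord y k) * coord v k) \<longlonglongrightarrow> cinner w x"
    using tendsto_cong by fastforce
qed

text \<open>Both sides are continuous in \<open>(x, v)\<close>. Only one of the two pairs ranges
  over \<open>Jmax\<close>: with both there, the Wronskian need not tend to zero.\<close>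

lemma green:
  assumes yw: "(y, w) \<in> Jmax" and xv: "(x, v) \<in> J"
  shows "cinner y v = cinner w x"
proof -
  from J_sequentialE[OF xv]
  obtain X V where XV: "\<And>n. (X n, V n) \<in> jacobi_finite q b" "X \<longlonglongrightarrow> x" "V \<longlonglongrightarrow> v"
    by metis
  have "(\<lambda>n. cinner y (V n)) \<longlonglongrightarrow> cinner y v" "(\<lambda>n. cinner w (X n)) \<longlonglongrightarrow> cinner w x"
    by (intro tendsto_cinner tendsto_const XV)+
  moreover have "cinner y (V n) = cinner w (X n)" for n
    by (rule green_finite[OF yw XV(1)])
  ultimately show ?thesis
    by (simp add: LIMSEQ_unique)
qed

lemma symmetric_J: "(y, w) \<in> J \<Longrightarrow> (x, v) \<in> J \<Longrightarrow> cinner y v = cinner w x"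
  using green J_subset_Jmax by blast

text \<open>One inclusion is Green's identity. For the other, testing on \<open>delta k\<close>
  already yields row k, the matrix being real and symmetric.\<close>

lemma adjoint_J: "adjoint_op J = Jmax"
proof
  show "Jmax \<subseteq> adjoint_op J"
    by (auto simp: adjoint_op_def green)
  show "adjoint_op J \<subseteq> Jmax"
  proof clarify
    fix y w assume "(y, w) \<in> adjoint_op J"
    then have "cinner y (Jdelta k) = cinner w (delta k)" for k
      unfolding adjoint_op_def using delta_Jdelta by blast
    then have "cinner (Jdelta k) y = coord w k" for k
      unfolding cinner_delta[symmetric] by (metis cinner_commute)
    moreover have "cinner (Jdelta k) y = L (coord y) k" for k
      by (cases k) (simp_all add: L_def Jdelta_def cinner_delta cinner_add_left cinner_scaleC_left)
    ultimately show "(y, w) \<in> Jmax"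
      by (simp add: Jmax_def)
  qed
qed

section \<open>Ranges of \<open>J - z\<close> and their orthogonal complements\<close>

lemma J_bounded_below:
  assumes "(x, v) \<in> J"
  shows "\<bar>Im z\<bar> * norm x \<le> norm (v - z *\<^sub>C x)"
proof (cases "x = 0")
  case False
  \<comment> \<open>By symmetry the inner product of \<open>x\<close> and \<open>v\<close> is real,
    so the imaginary part of the product with \<open>v - z x\<close> comes from \<open>z\<close>
    alone.\<close>
  have "cinner x v = cnj (cinner x v)"
    using symmetric_J[OF assms assms] cinner_commute[of x v] by simp
  then have "Im (cinner x v) = 0"
    by (metis Reals_cnj_iff complex_is_Real_iff)
  then have "\<bar>Im (cinner x (v - z *\<^sub>C x))\<bar> = \<bar>Im z\<bar> * (norm x)\<^sup>2"
    by (simp add: cinner_diff_right cinner_scaleC_right cinner_self abs_mult del: of_real_power)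
  then have "\<bar>Im z\<bar> * (norm x)\<^sup>2 \<le> norm x * norm (v - z *\<^sub>C x)"
    using abs_Im_le_cmod[of "cinner x (v - z *\<^sub>C x)"] cmod_cinner_le[of x "v - z *\<^sub>C x"] by linarith
  then have "norm x * (\<bar>Im z\<bar> * norm x) \<le> norm x * norm (v - z *\<^sub>C x)"
    by (simp add: power2_eq_square algebra_simps)
  then show ?thesis
    using False by simp
qed simp

definition ran :: "complex \<Rightarrow> ell2 set" where
  "ran z = {v - z *\<^sub>C x | x v. (x, v) \<in> J}"

lemma subspace_ran: "cvec.subspace (ran z)"
  unfolding cvec.subspace_def
proof (intro conjI ballI allI)
  show "0 \<in> ran z"
    unfolding ran_def mem_Collect_eq using linear_operatorD(2)[OF linear_J]
    by (intro exI[of _ 0]) simp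
next
  fix r r' assume "r \<in> ran z" "r' \<in> ran z"
  then obtain x v x' v' where "(x, v) \<in> J" "(x', v') \<in> J" and eq: "r = v - z *\<^sub>C x" "r' = v' - z *\<^sub>C x'"
    by (auto simp: ran_def)
  then have "(x + x', v + v') \<in> J"
    by (intro linear_operatorD(3)[OF linear_J])
  moreover have "r + r' = (v + v') - z *\<^sub>C (x + x')"
    by (simp add: eq scaleC_add_right)
  ultimately show "r + r' \<in> ran z"
    unfolding ran_def by blast
next
  fix c r assume "r \<in> ran z"
  then obtain x v where "(x, v) \<in> J" and eq: "r = v - z *\<^sub>C x"
    by (auto simp: ran_def)
  then have "(c *\<^sub>C x, c *\<^sub>C v) \<in> J"
    by (intro linear_operatorD(4)[OF linear_J])
  moreover have "c *\<^sub>C r = c *\<^sub>C v - z *\<^sub>C (c *\<^sub>C x)"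
    by (simp add: eq cvec.scale_right_diff_distrib mult.commute)
  ultimately show "c *\<^sub>C r \<in> ran z"
    unfolding ran_def by blast
qed

text \<open>By \<open>J_bounded_below\<close>, preimages of a convergent sequence in the range are
  Cauchy; closedness of \<open>J\<close> then identifies the limit.\<close>

lemma closed_ran:
  assumes z: "Im z \<noteq> 0"
  shows "closed (ran z)"
  unfolding closed_sequential_limits
proof (intro allI impI, elim conjE)
  fix R r assume "\<forall>n. R n \<in> ran z" and R: "R \<longlonglongrightarrow> r"
  then obtain X V where XV: "\<And>n. (X n, V n) \<in> J" and eq: "\<And>n. R n = V n - z *\<^sub>C X n"
    unfolding ran_def by simp metis
  have le: "norm (X m - X n) \<le> norm (R m - R n) / \<bar>Im z\<bar>" for m n
    using J_bounded_below[OF linear_operatorD(5)[OF linear_J XV[of m] XV[of n]], of z] z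
    by (simp add: eq field_simps cvec.scale_right_diff_distrib)
  have "Cauchy X"
  proof (rule CauchyI)
    fix e :: real assume "0 < e"
    then have "0 < e * \<bar>Im z\<bar>"
      using z by simp
    from CauchyD[OF LIMSEQ_imp_Cauchy[OF R] this]
    obtain M where M: "\<And>m n. m \<ge> M \<Longrightarrow> n \<ge> M \<Longrightarrow> norm (R m - R n) < e * \<bar>Im z\<bar>"
      by blast
    have "norm (X m - X n) < e" if "m \<ge> M" "n \<ge> M" for m n
      using order.strict_trans1[OF le, of m n e] M[OF that] z by (simp add: field_simps)
    then show "\<exists>M. \<forall>m\<ge>M. \<forall>n\<ge>M. norm (X m - X n) < e"
      by blast
  qed
  then obtain x where X: "X \<longlonglongrightarrow> x"
    using Cauchy_convergent convergent_def by blast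
  have "(\<lambda>n. R n + z *\<^sub>C X n) \<longlonglongrightarrow> r + z *\<^sub>C x"
    by (intro tendsto_intros tendsto_scaleC R X)
  then have "(\<lambda>n. (X n, V n)) \<longlonglongrightarrow> (x, r + z *\<^sub>C x)"
    by (intro tendsto_Pair X) (simp add: eq)
  then have "(x, r + z *\<^sub>C x) \<in> J"
    by (rule closed_sequentially[OF closed_J XV])
  moreover have "r = (r + z *\<^sub>C x) - z *\<^sub>C x"
    by simp
  ultimately show "r \<in> ran z"
    unfolding ran_def by blast
qed

text \<open>Project \<open>f\<close> onto the closed range. The remainder \<open>e\<close> is
  orthogonal to the range of J - z, which says that the adjoint sends \<open>e\<close> to
  \<open>cnj z\<close> times \<open>e\<close>.\<close>

lemma ran_decomposition:
  assumes "Im z \<noteq> 0"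
  obtains x v e where "(x, v) \<in> J" "f = v - z *\<^sub>C x + e" "(e, cnj z *\<^sub>C e) \<in> Jmax"
    "cinner (v - z *\<^sub>C x) e = 0"
proof -
  obtain s where s: "s \<in> ran z" "\<And>t. t \<in> ran z \<Longrightarrow> cinner t (f - s) = 0"
    using closed_subspace_projection[OF subspace_ran closed_ran[OF assms], of f] by blast
  then obtain x v where xv: "(x, v) \<in> J" "s = v - z *\<^sub>C x"
    by (auto simp: ran_def)
  have "cinner (f - s) v' = cinner (cnj z *\<^sub>C (f - s)) x'" if "(x', v') \<in> J" for x' v'
  proof -
    have "cinner (v' - z *\<^sub>C x') (f - s) = 0"
      by (rule s) (use that in \<open>auto simp: ran_def\<close>)
    then have "cinner (f - s) (v' - z *\<^sub>C x') = 0"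
      by (metis cinner_commute complex_cnj_zero)
    then show ?thesis
      by (simp add: cinner_diff_right cinner_scaleC_right cinner_scaleC_left)
  qed
  then have "(f - s, cnj z *\<^sub>C (f - s)) \<in> adjoint_op J"
    unfolding adjoint_op_def by auto
  then show thesis
    using that[OF xv(1), of "f - s"] s(2)[OF s(1)] by (simp add: adjoint_J xv(2))
qed

section \<open>Formal solutions of the three-term recurrence\<close>

fun sol :: "complex \<Rightarrow> complex \<Rightarrow> complex \<Rightarrow> nat \<Rightarrow> complex" where
  "sol z s0 s1 0 = s0"
| "sol z s0 s1 (Suc 0) = s1"
| "sol z s0 s1 (Suc (Suc k)) = ((z - complex_of_real (q (Suc k))) * sol z s0 s1 (Suc k) - complex_of_real (b k) * sol z s0 s1 k) / complex_of_real (b (Suc k))"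

text \<open>Every \<open>sol\<close> satisfies the eigenvalue equation in all rows but row 0. These
  initial values enforce row 0 as well and give the orthogonal polynomials of the first kind; those
  of \<open>Q\<close> leave a residue 1 in row 0 and give the second kind.\<close>

definition P :: "complex \<Rightarrow> nat \<Rightarrow> complex" where
  "P z = sol z 1 ((z - complex_of_real (q 0)) / complex_of_real (b 0))"

definition Q :: "complex \<Rightarrow> nat \<Rightarrow> complex" where
  "Q z = sol z 0 (1 / complex_of_real (b 0))"

lemma sol_Suc_Suc:
  "complex_of_real (b (Suc k)) * sol z s0 s1 (Suc (Suc k)) = (z - complex_of_real (q (Suc k))) * sol z s0 s1 (Suc k) - complex_of_real (b k) * sol z s0 s1 k"
  by simp

lemma P_0 [simp]: "P z 0 = 1" and Q_0 [simp]: "Q z 0 = 0"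
  by (simp_all add: P_def Q_def)

lemma L_sol: "L (sol z s0 s1) (Suc k) = z * sol z s0 s1 (Suc k)"
  unfolding L_def using sol_Suc_Suc[of k z s0 s1] by (simp add: algebra_simps del: sol.simps)

lemma L_P: "L (P z) k = z * P z k"
  by (cases k) (simp_all add: P_def L_sol, simp add: L_def)

lemma L_Q: "L (Q z) k = z * Q z k + (if k = 0 then 1 else 0)"
  by (cases k) (simp_all add: Q_def L_sol, simp add: L_def)

lemma sol_cnj: "sol (cnj z) (cnj s0) (cnj s1) k = cnj (sol z s0 s1 k)"
  by (induction z s0 s1 k rule: sol.induct) simp_all

lemma P_cnj: "P (cnj z) k = cnj (P z k)" and Q_cnj: "Q (cnj z) k = cnj (Q z k)"
  using sol_cnj[of z 1 "(z - complex_of_real (q 0)) / complex_of_real (b 0)" k] sol_cnj[of z 0 "1 / complex_of_real (b 0)" k] by (simp_all add: P_def Q_def)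

text \<open>Since \<open>b k\<close> is nonzero, row k determines entry k + 1 from the earlier ones,
  leaving only entry 0 free. The recurrence has order two, so the induction carries two consecutive
  entries.\<close>

lemma eigen_unique:
  assumes "\<And>k. L y k = z * y k"
  shows "y k = y 0 * P z k"
proof -
  have "y k = y 0 * P z k \<and> y (Suc k) = y 0 * P z (Suc k)"
  proof (induction k)
    case 0
    show ?case
      using assms[of 0] by (simp add: P_def L_def field_simps)
  next
    case (Suc k)
    have "b (Suc k) * y (Suc (Suc k)) = b (Suc k) * (y 0 * P z (Suc (Suc k)))"
    proof -
      have "b (Suc k) * y (Suc (Suc k)) = z * y (Suc k) - q (Suc k) * y (Suc k) - b k * y k"
        using assms[of "Suc k"] unfolding L_def by (simp add: algebra_simps)
      moreover have "b (Suc k) * P z (Suc (Suc k)) = z * P z (Suc k) - q (Suc k) * P z (Suc k) - b k * P z k"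
        using L_P[of z "Suc k"] unfolding L_def by (simp add: algebra_simps)
      ultimately show ?thesis
        unfolding distrib_left right_diff_distrib mult.left_commute[of _ "y 0"]
        using Suc by (simp add: right_diff_distrib mult_ac del: mult_cancel_left)
    qed
    then show ?case
      using Suc by simp
  qed
  then show ?thesis ..
qed

end


section \<open>Entire functions\<close>

text \<open>On the circle of radius \<open>R\<close> one has \<open>z\<^sup>2 - R\<^sup>2 = 2 \<i> z Im z\<close>, which compensates the
  singularity of the bound on the real axis.\<close>

lemma entire_eq_0_if_Im_bounded:
  assumes hol: "f holomorphic_on UNIV" and bound: "\<And>z. \<bar>Im z\<bar> * cmod (f z) \<le> C"
  shows "f z = 0"
proof (rule ccontr)
  assume "f z \<noteq> 0"
  then have a: "0 < cmod (f z)"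
    by simp
  have C: "0 \<le> C"
    using bound[of 0] by simp
  \<comment> \<open>This radius makes (R - |z|) |f z| exceed 2 C, which contradicts the maximum
    modulus bound for \<open>g\<close> on the disc.\<close>
  define R where "R = cmod z + 2 * C / cmod (f z) + 1"
  have R: "0 < R" "cmod z < R"
    using a C by (auto simp: R_def add_nonneg_pos)
  define g where "g w = (w\<^sup>2 - (complex_of_real R)\<^sup>2) * f w" for w
  have "cmod (g z) \<le> 2 * R * C"
  proof (rule maximum_modulus_frontier[of g "ball 0 R"])
    show "g holomorphic_on interior (ball 0 R)" "continuous_on (closure (ball 0 R)) g"
      unfolding g_def using hol
      by (auto intro!: holomorphic_intros holomorphic_on_imp_continuous_on intro: holomorphic_on_subset)
    fix w assume "w \<in> frontier (ball (0 :: complex) R)"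
    then have w: "cmod w = R"
      using R(1) by (simp add: dist_norm)
    have "(complex_of_real R)\<^sup>2 = w * cnj w"
      using complex_norm_square[of w] w by simp
    then have "w\<^sup>2 - (complex_of_real R)\<^sup>2 = w * (2 * Im w * \<i>)"
      by (simp add: power2_eq_square right_diff_distrib[symmetric] complex_diff_cnj)
    then have "cmod (g w) = 2 * R * (\<bar>Im w\<bar> * cmod (f w))"
      by (simp add: g_def norm_mult w)
    also have "\<dots> \<le> 2 * R * C"
      using R(1) bound[of w] by (intro mult_left_mono) auto
    finally show "cmod (g w) \<le> 2 * R * C" .
  qed (use R in auto)
  moreover have "(R - cmod z) * (R + cmod z) * cmod (f z) \<le> cmod (g z)"
  proof -
    have "R\<^sup>2 - (cmod z)\<^sup>2 \<le> cmod (z\<^sup>2 - (complex_of_real R)\<^sup>2)"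
      using norm_triangle_ineq2[of "(complex_of_real R)\<^sup>2" "z\<^sup>2"]
      by (simp add: norm_power norm_minus_commute)
    then show ?thesis
      unfolding g_def norm_mult by (intro mult_right_mono) (simp_all add: power2_eq_square algebra_simps)
  qed
  moreover have "2 * R * C < (R - cmod z) * (R + cmod z) * cmod (f z)"
  proof -
    have "2 * C < (R - cmod z) * cmod (f z)"
      using a by (simp add: R_def field_simps)
    then have "2 * C * R < (R - cmod z) * cmod (f z) * R"
      using R(1) by (intro mult_strict_right_mono)
    also have "\<dots> \<le> (R - cmod z) * cmod (f z) * (R + cmod z)"
      using R a by (intro mult_left_mono) auto
    finally show ?thesis
      by (simp add: mult_ac)
  qed
  ultimately show False
    by linarith
qed

text \<open>Borel--Caratheodory for the derivative at a point: apply the Schwarz lemma to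
  \<open>h (R z) / (2 A - h (R z))\<close>.\<close>

lemma norm_deriv_le_if_Re_bounded:
  assumes hol: "h holomorphic_on UNIV" and h0: "h 0 = 0" and R: "0 < R" and A: "0 < A"
    and bound: "\<And>z. cmod z < R \<Longrightarrow> Re (h z) < A"
  shows "cmod (deriv h 0) \<le> 2 * A / R"
proof -
  define F where "F z = h (R * z) / (2 * complex_of_real A - h (R * z))" for z :: complex
  have lt: "Re (h (R * z)) < A" if "cmod z < 1" for z :: complex
    using bound[of "R * z"] that R by (simp add: norm_mult)
  have ne: "2 * complex_of_real A - h (R * z) \<noteq> 0" if "cmod z < 1" for z :: complex
    using lt[OF that] A by (auto simp: complex_eq_iff)
  have "(h \<circ> (\<lambda>z. R * z)) holomorphic_on ball 0 1"
    by (rule holomorphic_on_compose) (auto intro!: holomorphic_intros holomorphic_on_subset[OF hol])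
  then have "(\<lambda>z. h (R * z)) holomorphic_on ball 0 1"
    by (simp add: o_def)
  then have "F holomorphic_on ball 0 1"
    unfolding F_def
    by (intro holomorphic_on_divide holomorphic_on_diff holomorphic_on_const ne) simp_all
  moreover have "cmod (F z) < 1" if "cmod z < 1" for z
  proof -
    \<comment> \<open>A point with real part below A is closer to 0 than to 2 A; in squares this
      reads A Re h < A A.\<close>
    have "(cmod (h (R * z)))\<^sup>2 < (cmod (2 * complex_of_real A - h (R * z)))\<^sup>2"
      using mult_strict_left_mono[OF lt[OF that] A]
      unfolding cmod_power2 by (simp add: power2_eq_square algebra_simps)
    then have lt: "cmod (h (R * z)) < cmod (2 * complex_of_real A - h (R * z))"
      by (rule power_less_imp_less_base) simp
    show ?thesis
      unfolding F_def norm_divide divide_less_eq_1_pos[OF order.strict_trans1[OF norm_ge_zero lt]]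
      by (rule lt)
  qed
  ultimately have "cmod (deriv F 0) \<le> 1"
    using Schwarz_Lemma(2)[of F 0] by (simp add: F_def h0)
  moreover have "deriv F 0 = R * deriv h 0 / (2 * A)"
  proof (rule DERIV_imp_deriv)
    have D: "((\<lambda>z. h (R * z)) has_field_derivative R * deriv h 0) (at 0)"
      using DERIV_chain'[of "\<lambda>z. R * z" R 0 UNIV h "deriv h 0"] holomorphic_derivI[OF hol, of 0]
        DERIV_cmult_Id[of "complex_of_real R" 0 UNIV]
      by (simp add: mult.commute[of "deriv h 0"])
    show "(F has_field_derivative R * deriv h 0 / (2 * A)) (at 0)"
      unfolding F_def by (rule derivative_eq_intros D refl)+ (use A h0 in \<open>auto simp: field_simps\<close>)
  qed
  ultimately show ?thesis
    using R A by (simp add: norm_mult norm_divide field_simps)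
qed

text \<open>Without zeros, G = exp H on the plane. Minimal type makes Re H grow slower than every
  linear function, and Borel-Caratheodory on large discs about any point makes the derivative of H
  vanish there.\<close>

lemma zero_free_minimal_type_const:
  assumes hol: "G holomorphic_on UNIV" and nz: "\<And>z. G z \<noteq> 0"
    and type: "\<And>e. 0 < e \<Longrightarrow> \<exists>C. \<forall>z. cmod (G z) \<le> C * exp (e * cmod z)"
  obtains c where "\<And>z. G z = c"
proof -
  obtain H where H: "H holomorphic_on UNIV" "\<And>z. G z = exp (H z)"
    using contractible_imp_holomorphic_log[OF hol contractible_UNIV] nz by auto
  have "deriv H w = 0" for w
  proof -
    define h where "h z = H (w + z) - H w" for z
    have "(H \<circ> (\<lambda>z. w + z)) holomorphic_on UNIV"
      by (rule holomorphic_on_compose) (auto intro!: holomorphic_intros holomorphic_on_subset[OF H(1)])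
    then have hol_h: "h holomorphic_on UNIV"
      unfolding h_def by (auto intro!: holomorphic_intros simp: o_def)
    have deriv: "deriv h 0 = deriv H w"
    proof (rule DERIV_imp_deriv)
      have D: "((\<lambda>z. H (w + z)) has_field_derivative deriv H w) (at 0)"
      proof -
        have "((\<lambda>z. w + z) has_field_derivative 0 + 1) (at 0)"
          by (intro DERIV_add DERIV_const DERIV_ident)
        then show ?thesis
          using DERIV_chain'[of "\<lambda>z. w + z" 1 0 UNIV H "deriv H w"] holomorphic_derivI[OF H(1), of w]
          by simp
      qed
      show "(h has_field_derivative deriv H w) (at 0)"
        unfolding h_def by (rule derivative_eq_intros D refl)+ simp
    qed
    have "cmod (deriv H w) \<le> 0 + e" if "0 < e" for e
    proof -
      obtain C where C: "\<And>z. cmod (G z) \<le> C * exp (e / 4 * cmod z)"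
        using type[of "e / 4"] \<open>0 < e\<close> by auto
      have "0 < cmod (G 0)" "cmod (G 0) \<le> C"
        using nz C[of 0] by auto
      then have "0 < C"
        by linarith
      \<comment> \<open>\<open>K\<close> collects the constant terms in the bound on Re h, with 1
        keeping it positive. The choice of \<open>R\<close> splits the final bound 2 (e R / 4 + K) /
        R into e / 2 + e / 2.\<close>
      define K where "K = max 1 (ln C + e / 4 * cmod w - Re (H w))"
      define R where "R = 4 * K / e"
      have K: "0 < K" and R: "0 < R"
        using \<open>0 < e\<close> by (auto simp: K_def R_def)
      have Re_H: "Re (H z) \<le> ln C + e / 4 * cmod z" for z
      proof -
        have "exp (Re (H z)) \<le> exp (ln C + e / 4 * cmod z)"
          using C[of z] \<open>0 < C\<close> by (simp add: H(2) exp_add)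
        then show ?thesis
          by simp
      qed
      have "Re (h z) < e / 4 * R + K" if "cmod z < R" for z
      proof -
        have "cmod (w + z) \<le> cmod w + cmod z"
          by (rule norm_triangle_ineq)
        then have "e / 4 * cmod (w + z) \<le> e / 4 * (cmod w + cmod z)"
          using \<open>0 < e\<close> by (intro mult_left_mono) auto
        moreover have "e / 4 * cmod z < e / 4 * R"
          using \<open>0 < e\<close> that by (intro mult_strict_left_mono) auto
        ultimately show ?thesis
          using Re_H[of "w + z"] unfolding h_def K_def distrib_left by simp
      qed
      then have "cmod (deriv h 0) \<le> 2 * (e / 4 * R + K) / R"
        using \<open>0 < e\<close> K R
        by (intro norm_deriv_le_if_Re_bounded hol_h) (auto simp: h_def intro!: add_pos_pos)
      also have "\<dots> = e"
        using \<open>0 < e\<close> K by (simp add: R_def field_simps)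
      finally show ?thesis
        by (simp add: deriv)
    qed
    then have "cmod (deriv H w) \<le> 0"
      by (rule field_le_epsilon)
    then show ?thesis
      by simp
  qed
  then have "(H has_field_derivative 0) (at w)" for w
    using holomorphic_derivI[OF H(1), of w] by simp
  then obtain c where "\<And>z. H z = c"
    using has_field_derivative_zero_constant[of UNIV H] by auto
  then show thesis
    using that[of "exp c"] H(2) by simp
qed

text \<open>The M-test gives uniform convergence on each closed unit disc, and locally uniform
  limits of holomorphic functions are holomorphic.\<close>

lemma entire_suminf:
  fixes f :: "nat \<Rightarrow> complex \<Rightarrow> complex"
  assumes hol: "\<And>k. f k holomorphic_on UNIV"
    and bound: "\<And>R. \<exists>M. summable M \<and> (\<forall>k z. cmod z \<le> R \<longrightarrow> cmod (f k z) \<le> M k)"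
  shows "(\<lambda>z. \<Sum>k. f k z) holomorphic_on UNIV"
proof (rule holomorphic_uniform_sequence[OF open_UNIV, of "\<lambda>n z. \<Sum>k<n. f k z"])
  show "(\<lambda>z. \<Sum>k<n. f k z) holomorphic_on UNIV" for n
    by (intro holomorphic_intros hol)
  fix z :: complex
  obtain M where M: "summable M" "\<And>k w. cmod w \<le> cmod z + 1 \<Longrightarrow> cmod (f k w) \<le> M k"
    using bound by blast
  have "cmod (f k w) \<le> M k" if "w \<in> cball z 1" for k w
  proof (rule M)
    show "cmod w \<le> cmod z + 1"
      using norm_triangle_sub[of w z] that by (simp add: dist_norm norm_minus_commute)
  qed
  from Weierstrass_m_test[OF this M(1)]
  have "uniform_limit (cball z 1) (\<lambda>n w. \<Sum>k<n. f k w) (\<lambda>w. \<Sum>k. f k w) sequentially" .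
  then show "\<exists>d>0. cball z d \<subseteq> UNIV
      \<and> uniform_limit (cball z d) (\<lambda>n w. \<Sum>k<n. f k w) (\<lambda>w. \<Sum>k. f k w) sequentially"
    by (intro exI[of _ 1]) simp
qed

text \<open>Cut where the tail of the sum is at most e / 2. The tail factors contribute at most exp
  (e r / 2) since 1 + x \<le> exp x; the finitely many others form a polynomial in r, absorbed by C
  exp (e r / 2). Hence C is independent of n.\<close>

lemma prod_minimal_type:
  fixes a :: "nat \<Rightarrow> real"
  assumes nonneg: "\<And>k. 0 \<le> a k" and sum: "summable a" and e: "0 < e"
  obtains C where "0 \<le> C" "\<And>r n. 0 \<le> r \<Longrightarrow> (\<Prod>j<n. 1 + r * a j) \<le> C * exp (e * r)"
proof -
  have finite: "\<exists>C\<ge>0. \<forall>r\<ge>0. (\<Prod>j<n. 1 + r * a j) \<le> C * exp (e * r)" if "0 < e" for n e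
    using that
  proof (induction n arbitrary: e)
    case 0
    then show ?case
      by (intro exI[of _ 1]) simp
  next
    case (Suc n)
    obtain C where C: "0 \<le> C" "\<And>r. 0 \<le> r \<Longrightarrow> (\<Prod>j<n. 1 + r * a j) \<le> C * exp (e / 2 * r)"
      using Suc.IH[of "e / 2"] Suc.prems by auto
    \<comment> \<open>The maximum ensures both 1 \<le> D and a n \<le> D e / 2, so 1 + r a n \<le> D
      (1 + e r / 2).\<close>
    define D where "D = max 1 (a n / (e / 2))"
    have factor: "1 + r * a n \<le> D * exp (e / 2 * r)" if "0 \<le> r" for r
    proof -
      have "a n / (e / 2) * (e / 2 * r) \<le> D * (e / 2 * r)"
        unfolding D_def using Suc.prems that by (intro mult_right_mono) auto
      moreover have "a n / (e / 2) * (e / 2 * r) = r * a n"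
        using Suc.prems by simp
      moreover have "1 \<le> D"
        by (simp add: D_def)
      ultimately have "1 + r * a n \<le> D * (1 + e / 2 * r)"
        unfolding distrib_left by linarith
      also have "\<dots> \<le> D * exp (e / 2 * r)"
        by (intro mult_left_mono exp_ge_add_one_self) (simp add: D_def)
      finally show ?thesis .
    qed
    have "(\<Prod>j<Suc n. 1 + r * a j) \<le> C * D * exp (e * r)" if "0 \<le> r" for r
    proof -
      have "(\<Prod>j<Suc n. 1 + r * a j) \<le> (C * exp (e / 2 * r)) * (D * exp (e / 2 * r))"
        unfolding prod.lessThan_Suc using C that nonneg factor by (intro mult_mono) auto
      also have "\<dots> = C * D * exp (e / 2 * r + e / 2 * r)"
        by (simp only: exp_add mult_ac)
      finally show ?thesis
        by simp
    qed
    then show ?case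
      using C(1) by (intro exI[of _ "C * D"]) (simp add: D_def)
  qed
  obtain N where "norm (\<Sum>j. a (j + N)) < e / 2"
    using suminf_exist_split[OF _ sum, of "e / 2"] e by auto
  then have tail: "(\<Sum>j<n. a (j + N)) \<le> e / 2" for n
    using sum_le_suminf[OF summable_ignore_initial_segment[OF sum], of "{..<n}" N] nonneg by auto
  obtain C where C: "0 \<le> C" "\<And>r. 0 \<le> r \<Longrightarrow> (\<Prod>j<N. 1 + r * a j) \<le> C * exp (e / 2 * r)"
    using finite[of "e / 2" N] e by auto
  have step: "(\<Prod>j<n + N. 1 + r * a j) \<le> C * exp (e / 2 * r) * exp (r * (\<Sum>j<n. a (j + N)))"
    if "0 \<le> r" for n r
  proof (induction n)
    case (Suc n)
    have "(\<Prod>j<Suc n + N. 1 + r * a j)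
        \<le> (C * exp (e / 2 * r) * exp (r * (\<Sum>j<n. a (j + N)))) * exp (r * a (n + N))"
      unfolding add_Suc prod.lessThan_Suc using Suc.IH that nonneg C(1)
      by (intro mult_mono exp_ge_add_one_self) auto
    then show ?case
      by (simp add: exp_add distrib_left mult.assoc)
  qed (use C that in simp)
  have "(\<Prod>j<n. 1 + r * a j) \<le> C * exp (e * r)" if "0 \<le> r" for r n
  proof -
    \<comment> \<open>All factors are at least 1, so the product may be lengthened until
      \<open>step\<close> applies.\<close>
    have "(\<Prod>j<n. 1 + r * a j) \<le> (\<Prod>j<n + N. 1 + r * a j)"
      using that nonneg by (intro prod_mono2) auto
    also have "\<dots> \<le> C * exp (e / 2 * r) * exp (r * (\<Sum>j<n. a (j + N)))"
      by (rule step[OF that])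
    also have "\<dots> \<le> C * exp (e / 2 * r) * exp (r * (e / 2))"
      using C(1) that by (intro mult_left_mono iffD2[OF exp_le_cancel_iff] tail) auto
    also have "\<dots> = C * exp (e / 2 * r + r * (e / 2))"
      by (simp only: exp_add mult.assoc)
    also have "e / 2 * r + r * (e / 2) = e * r"
      by simp
    finally show ?thesis .
  qed
  then show thesis
    using that C(1) by blast
qed


section \<open>Gram--Schmidt orthonormalization\<close>

text \<open>Normalizing by \<open>sgn\<close> gives \<open>w n\<close> a positive coefficient along
  the new vector; positivity of the off-diagonal matrix entries will rest on this.\<close>

function gram_schmidt :: "(nat \<Rightarrow> 'a) \<Rightarrow> nat \<Rightarrow> 'a::chilbert_space" where
  "gram_schmidt w n = sgn (w n - (\<Sum>j<n. cinner (gram_schmidt w j) (w n) *\<^sub>C gram_schmidt w j))"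
  by auto
termination by (relation "Wellfounded.measure snd") auto

declare gram_schmidt.simps [simp del]

definition orthonormal :: "(nat \<Rightarrow> 'a::chilbert_space) \<Rightarrow> bool" where
  "orthonormal v \<longleftrightarrow> (\<forall>j k. cinner (v j) (v k) = (if j = k then 1 else 0))"

lemma subspace_orthogonal: "cvec.subspace {t. cinner x t = 0}"
  by (simp add: cvec.subspace_def cinner_add_right cinner_scaleC_right)

lemma orthonormal_span:
  assumes "orthonormal v" "t \<in> cvec.span (v ` {..<n})" "n \<le> m"
  shows "cinner (v m) t = 0"
proof -
  have "cvec.span (v ` {..<n}) \<subseteq> {t. cinner (v m) t = 0}"
    using assms(1,3) by (intro cvec.span_minimal subspace_orthogonal) (auto simp: orthonormal_def)
  then show ?thesis
    using assms(2) by blast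
qed

context
  fixes w :: "nat \<Rightarrow> 'a::chilbert_space"
  assumes indep: "w n \<notin> cvec.span (w ` {..<n})"
begin

abbreviation "gs \<equiv> gram_schmidt w"

text \<open>The claims support each other: the residue at n exchanges \<open>w n\<close> and
  \<open>gs n\<close> between the spans, and equality of the spans keeps the next residual nonzero
  by independence.\<close>

lemma gram_schmidt_span_residue:
  "cvec.span (gs ` {..<n}) = cvec.span (w ` {..<n}) \<and>
   (\<exists>r>0. w n - r *\<^sub>R gs n \<in> cvec.span (gs ` {..<n}))"
proof (induction n)
  case 0
  have "w 0 \<noteq> 0"
    using indep[of 0] by simp
  then show ?case
    by (auto intro!: exI[of _ "norm (w 0)"] simp: gram_schmidt.simps[of w 0] sgn_div_norm)
next
  case (Suc n)
  then obtain r where r: "0 < r" "w n - r *\<^sub>R gs n \<in> cvec.span (gs ` {..<n})"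
    by blast
  have sub: "cvec.span (gs ` {..<n}) \<subseteq> cvec.span (gs ` {..<Suc n})"
    "cvec.span (w ` {..<n}) \<subseteq> cvec.span (w ` {..<Suc n})"
    by (intro cvec.span_mono image_mono; auto)+
  have gs_n: "gs n \<in> cvec.span (gs ` {..<Suc n})" and w_n: "w n \<in> cvec.span (w ` {..<Suc n})"
    by (intro cvec.span_base; auto)+
  have span: "cvec.span (gs ` {..<Suc n}) = cvec.span (w ` {..<Suc n})"
  proof -
    have "(w n - r *\<^sub>R gs n) + r *\<^sub>R gs n \<in> cvec.span (gs ` {..<Suc n})"
      unfolding scaleR_eq_scaleC
      by (rule cvec.span_add[OF subsetD[OF sub(1)] cvec.span_scale[OF gs_n]])
        (rule r(2)[unfolded scaleR_eq_scaleC])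
    then have "w n \<in> cvec.span (gs ` {..<Suc n})"
      by simp
    moreover have "w n - (w n - r *\<^sub>R gs n) \<in> cvec.span (w ` {..<Suc n})"
      using r(2) unfolding Suc[THEN conjunct1] by (rule cvec.span_diff[OF w_n subsetD[OF sub(2)]])
    then have "(1 / r) *\<^sub>R (r *\<^sub>R gs n) \<in> cvec.span (w ` {..<Suc n})"
      unfolding scaleR_eq_scaleC[of "1 / r"] by (intro cvec.span_scale) simp
    then have "gs n \<in> cvec.span (w ` {..<Suc n})"
      using r(1) by simp
    moreover have "gs ` {..<n} \<subseteq> cvec.span (gs ` {..<n})" "w ` {..<n} \<subseteq> cvec.span (w ` {..<n})"
      by (rule cvec.span_superset)+
    ultimately show ?thesis
      using Suc sub unfolding cvec.span_eq lessThan_Suc image_insert by auto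
  qed
  define s where "s = (\<Sum>j<Suc n. cinner (gs j) (w (Suc n)) *\<^sub>C gs j)"
  have s: "s \<in> cvec.span (gs ` {..<Suc n})"
    unfolding s_def by (intro cvec.span_sum cvec.span_scale cvec.span_base) auto
  have "w (Suc n) - s \<noteq> 0"
    using indep[of "Suc n"] s unfolding span by auto
  moreover have "gs (Suc n) = sgn (w (Suc n) - s)"
    unfolding s_def by (rule gram_schmidt.simps)
  ultimately have res: "0 < norm (w (Suc n) - s)" "w (Suc n) - norm (w (Suc n) - s) *\<^sub>R gs (Suc n) = s"
    by (simp_all add: sgn_div_norm)
  show ?case
    using span res s by (metis (no_types))
qed

lemma orthonormal_gram_schmidt: "orthonormal gs"
proof -
  have *: "\<forall>j<n. \<forall>k<n. cinner (gs j) (gs k) = (if j = k then 1 else 0)" for n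
  proof (induction n)
    case (Suc n)
    define s where "s = (\<Sum>j<n. cinner (gs j) (w n) *\<^sub>C gs j)"
    have gs: "gs n = sgn (w n - s)"
      unfolding s_def by (rule gram_schmidt.simps)
    have "s \<in> cvec.span (gs ` {..<n})"
      unfolding s_def by (intro cvec.span_sum cvec.span_scale cvec.span_base) auto
    then have "w n - s \<noteq> 0"
      using indep[of n] gram_schmidt_span_residue[of n] by auto
    then have n: "cinner (gs n) (gs n) = 1"
      by (simp add: cinner_self gs norm_sgn)
    have "cinner (gs j) (gs n) = 0" if "j < n" for j
    proof -
      have "cinner (gs j) s = (\<Sum>i<n. if i = j then cinner (gs j) (w n) else 0)"
        unfolding s_def cinner_sum_right using Suc that
        by (intro sum.cong) (auto simp: cinner_scaleC_right)
      then have "cinner (gs j) (w n - s) = 0"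
        using that by (simp add: cinner_diff_right)
      then show ?thesis
        by (simp add: gs sgn_div_norm scaleR_eq_scaleC cinner_scaleC_right)
    qed
    moreover from this have "cinner (gs n) (gs j) = 0" if "j < n" for j
      using that by (metis cinner_commute complex_cnj_zero)
    ultimately show ?case
      using Suc n by (auto simp: less_Suc_eq)
  qed simp
  show ?thesis
    unfolding orthonormal_def
  proof (intro allI)
    show "cinner (gs j) (gs k) = (if j = k then 1 else 0)" for j k
      using *[of "Suc (max j k)"] by (simp add: less_Suc_eq_le)
  qed
qed

end

text \<open>The error of the Fourier sum is orthogonal to the span, while the sum minus
  \<open>y\<close> lies in it; Pythagoras gives the inequality.\<close>

lemma orthonormal_best_approximation:
  assumes v: "orthonormal v" and y: "y \<in> cvec.span (v ` {..<n})"
  shows "norm (x - (\<Sum>k<n. cinner (v k) x *\<^sub>C v k)) \<le> norm (x - y)"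
proof -
  define s where "s = (\<Sum>k<n. cinner (v k) x *\<^sub>C v k)"
  have s: "s \<in> cvec.span (v ` {..<n})"
    unfolding s_def by (intro cvec.span_sum cvec.span_scale cvec.span_base) auto
  have "cinner (v j) (x - s) = 0" if "j < n" for j
  proof -
    have "cinner (v j) s = (\<Sum>k<n. if k = j then cinner (v j) x else 0)"
      unfolding s_def cinner_sum_right using v
      by (intro sum.cong) (auto simp: cinner_scaleC_right orthonormal_def)
    then show ?thesis
      using that by (simp add: cinner_diff_right)
  qed
  then have "cinner (x - s) (v j) = 0" if "j < n" for j
    using that by (metis cinner_commute complex_cnj_zero)
  then have "cvec.span (v ` {..<n}) \<subseteq> {t. cinner (x - s) t = 0}"
    by (intro cvec.span_minimal subspace_orthogonal) auto
  then have "cinner (x - s) (s - y) = 0"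
    using cvec.span_diff[OF s y] by blast
  then have "inner (x - s) (s - y) = 0"
    by (simp add: inner_eq_Re_cinner)
  moreover have "(norm (a + c))\<^sup>2 = (norm a)\<^sup>2 + (norm c)\<^sup>2" if "inner a c = 0" for a c :: 'a
    using that by (simp add: power2_norm_eq_inner inner_add_left inner_add_right inner_commute[of c a])
  ultimately have "(norm ((x - s) + (s - y)))\<^sup>2 = (norm (x - s))\<^sup>2 + (norm (s - y))\<^sup>2"
    by blast
  then have "(norm (x - s))\<^sup>2 \<le> (norm (x - y))\<^sup>2"
    by simp
  then show ?thesis
    unfolding s_def by (rule power2_le_imp_le) simp
qed

text \<open>Truncations of \<open>x\<close> converge to \<open>x\<close> and lie in the spans, so
  the better approximating Fourier sums converge too. The bound k + 2 fits a sequence with one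
  vector put in front of \<open>delta 0\<close>: there \<open>delta k\<close> has index k +
  1.\<close>

lemma orthonormal_basis_if_delta_in_span:
  assumes v: "orthonormal v" and delta: "\<And>k. delta k \<in> cvec.span (v ` {..<k + 2})"
  shows "orthonormal_basis v"
  unfolding orthonormal_basis_def
proof (intro conjI allI)
  show "cinner (v j) (v k) = (if j = k then 1 else 0)" for j k
    using v by (simp add: orthonormal_def)
next
  fix x :: ell2
  define T where "T n = (\<Sum>k<n. coord x k *\<^sub>C delta k)" for n
  have T: "T n \<in> cvec.span (v ` {..<Suc n})" for n
    unfolding T_def
  proof (intro cvec.span_sum cvec.span_scale)
    fix k assume "k \<in> {..<n}"
    then have "cvec.span (v ` {..<k + 2}) \<subseteq> cvec.span (v ` {..<Suc n})"
      by (intro cvec.span_mono image_mono) auto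
    then show "delta k \<in> cvec.span (v ` {..<Suc n})"
      using delta by blast
  qed
  have "T \<longlonglongrightarrow> x"
    using delta_expansion[of x] by (simp add: sums_def T_def[abs_def])
  then have "(\<lambda>n. norm (x - T n)) \<longlonglongrightarrow> norm (x - x)"
    by (intro tendsto_intros)
  then have lim: "(\<lambda>n. norm (x - T n)) \<longlonglongrightarrow> 0"
    by simp
  have "(\<lambda>n. norm (x - (\<Sum>k<Suc n. cinner (v k) x *\<^sub>C v k))) \<longlonglongrightarrow> 0"
    by (rule Lim_null_comparison[OF _ lim])
      (auto intro!: always_eventually orthonormal_best_approximation v T simp del: sum.lessThan_Suc)
  then have "(\<lambda>n. x - (\<Sum>k<Suc n. cinner (v k) x *\<^sub>C v k)) \<longlonglongrightarrow> 0"
    by (subst tendsto_norm_zero_iff[symmetric])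
  then have "(\<lambda>n. x - (x - (\<Sum>k<Suc n. cinner (v k) x *\<^sub>C v k))) \<longlonglongrightarrow> x - 0"
    by (intro tendsto_intros)
  then have "(\<lambda>n. \<Sum>k<Suc n. cinner (v k) x *\<^sub>C v k) \<longlonglongrightarrow> x"
    by (simp del: sum.lessThan_Suc)
  then show "(\<lambda>k. cinner (v k) x *\<^sub>C v k) sums x"
    unfolding sums_def by (rule LIMSEQ_imp_Suc)
qed


section \<open>Jacobi bases of a selfadjoint Jacobi operator\<close>

context jacobi
begin

text \<open>If finite combinations of \<open>v\<close> reach every \<open>delta k\<close>, a closed
  \<open>B\<close> agreeing with \<open>J\<close> on \<open>v\<close> agrees with it on all finitely
  supported sequences, hence contains the closure.\<close>

lemma basis_of_representation_J:
  assumes v: "orthonormal_basis v" and dom: "\<And>k. v k \<in> Domain J"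
    and delta: "\<And>k. delta k \<in> cvec.span (range v)"
  shows "basis_of_representation J v"
  unfolding basis_of_representation_def
proof (intro conjI allI impI closed_operator_J v dom, elim conjE)
  fix B assume B: "closed_operator B" and eq: "\<forall>k. v k \<in> Domain B \<and> op_apply B (v k) = op_apply J (v k)"
  then have lin: "linear_operator B" "linear_operator (B \<inter> J)"
    by (auto simp: closed_operator_def intro: linear_operator_Int linear_J)
  have "(v k, op_apply J (v k)) \<in> B \<inter> J" for k
    using op_apply_mem[OF lin(1)] op_apply_mem[OF linear_J dom] eq by (metis IntI)
  then have "cvec.span (range v) \<subseteq> Domain (B \<inter> J)"
    by (intro cvec.span_minimal subspace_Domain lin) blast
  then have in_Dom: "delta k \<in> Domain (B \<inter> J)" for k
    using delta by blast
  have "jacobi_finite q b \<subseteq> B"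
  proof clarify
    fix x v assume xv: "(x, v) \<in> jacobi_finite q b"
    then obtain N where N: "\<And>k. coord x k \<noteq> 0 \<Longrightarrow> k < N"
      unfolding jacobi_finite_iff finite_nat_set_iff_bounded by blast
    have "x = (\<Sum>k<N. coord x k *\<^sub>C delta k)"
      by (rule ell2_eqI) (use N in \<open>auto simp: coord_partial_sum\<close>)
    moreover have "(\<Sum>k<N. coord x k *\<^sub>C delta k) \<in> Domain (B \<inter> J)"
      by (intro cvec.subspace_sum cvec.subspace_scale subspace_Domain lin in_Dom)
    ultimately obtain y where "(x, y) \<in> B" "(x, y) \<in> J"
      by auto
    moreover have "(x, v) \<in> J"
      unfolding J_def using xv closure_subset by blast
    ultimately show "(x, v) \<in> B"
      using linear_operatorD(1)[OF linear_J] by blast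
  qed
  then show "J \<subseteq> B"
    unfolding J_def using B by (intro closure_minimal) (auto simp: closed_operator_def)
qed

lemma delta_in_jacobi_bases: "delta \<in> jacobi_bases J"
proof -
  have "basis_of_representation J delta"
    by (intro basis_of_representation_J orthonormal_basis_delta DomainI[OF delta_Jdelta] cvec.span_base) auto
  moreover have "op_apply J (delta k) = Jdelta k" for k
    by (rule op_apply_eq[OF linear_J delta_Jdelta])
  then have "jacobi_matrix (matrix_representation J delta)"
    unfolding jacobi_matrix_def matrix_representation_def cinner_delta
    using b_pos by (intro exI[of _ q] exI[of _ b]) (auto simp: Jdelta_def)
  ultimately show ?thesis
    by (simp add: jacobi_bases_def)
qed

text \<open>\<open>J\<close> raises the spans of initial segments by one index, so the matrix
  vanishes below the subdiagonal, and symmetry reflects this above the diagonal. Passing from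
  \<open>w\<close> to \<open>v\<close> only rescales the subdiagonal by positive factors.\<close>

lemma jacobi_matrix_if_hessenberg:
  assumes v: "orthonormal v"
    and span: "\<And>n. cvec.span (v ` {..<n}) = cvec.span (w ` {..<n})"
    and r: "\<And>n. 0 < r n" "\<And>n. w n - r n *\<^sub>R v n \<in> cvec.span (v ` {..<n})"
    and y: "\<And>n. (w n, y n) \<in> J"
    and \<beta>: "\<And>n. 0 < \<beta> n" "\<And>n. y n - \<beta> n *\<^sub>R w (Suc n) \<in> cvec.span (w ` {..<Suc n})"
  shows "v n \<in> Domain J" "jacobi_matrix (matrix_representation J v)"
proof -
  \<comment> \<open>\<open>Sp n\<close> uses indices below n: thus \<open>v n\<close> lies in
    \<open>Sp (n + 1)\<close> and its image in \<open>Sp (n + 2)\<close>.\<close>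
  define Sp where "Sp n = cvec.span (v ` {..<n})" for n
  have Sp_mono: "Sp m \<subseteq> Sp n" if "m \<le> n" for m n
    unfolding Sp_def using that by (intro cvec.span_mono image_mono) auto
  have Sp_sub: "cvec.subspace (Sp n)" for n
    by (simp add: Sp_def)
  have w_Sp: "w n \<in> Sp (Suc n)" and v_Sp: "v n \<in> Sp (Suc n)" for n
  proof -
    show "v n \<in> Sp (Suc n)"
      unfolding Sp_def by (rule cvec.span_base) auto
    show "w n \<in> Sp (Suc n)"
      unfolding Sp_def span by (rule cvec.span_base) auto
  qed
  have J_Sp: "\<exists>z\<in>Sp (Suc n). (x, z) \<in> J" if "x \<in> Sp n" for x n
  proof -
    \<comment> \<open>The vectors mapped into \<open>Sp (Suc n)\<close> form a subspace, so it
      suffices to test the generators \<open>w j\<close>.\<close>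
    have "cvec.subspace {x. \<exists>z\<in>Sp (Suc n). (x, z) \<in> J}"
      unfolding cvec.subspace_def
    proof (intro conjI ballI allI)
      show "0 \<in> {x. \<exists>z\<in>Sp (Suc n). (x, z) \<in> J}"
        using linear_operatorD(2)[OF linear_J] cvec.subspace_0[OF Sp_sub] by blast
    next
      fix x y assume "x \<in> {x. \<exists>z\<in>Sp (Suc n). (x, z) \<in> J}" "y \<in> {x. \<exists>z\<in>Sp (Suc n). (x, z) \<in> J}"
      then show "x + y \<in> {x. \<exists>z\<in>Sp (Suc n). (x, z) \<in> J}"
        using linear_operatorD(3)[OF linear_J] cvec.subspace_add[OF Sp_sub] by blast
    next
      fix c x assume "x \<in> {x. \<exists>z\<in>Sp (Suc n). (x, z) \<in> J}"
      then show "c *\<^sub>C x \<in> {x. \<exists>z\<in>Sp (Suc n). (x, z) \<in> J}"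
        using linear_operatorD(4)[OF linear_J] cvec.subspace_scale[OF Sp_sub] by blast
    qed
    moreover have "w ` {..<n} \<subseteq> {x. \<exists>z\<in>Sp (Suc n). (x, z) \<in> J}"
    proof clarsimp
      fix j assume "j < n"
      have "(y j - \<beta> j *\<^sub>R w (Suc j)) + \<beta> j *\<^sub>R w (Suc j) \<in> Sp (Suc (Suc j))"
        unfolding scaleR_eq_scaleC
        using \<beta>(2)[of j] w_Sp[of "Suc j"] Sp_mono[of "Suc j" "Suc (Suc j)"]
        by (intro cvec.subspace_add cvec.subspace_scale Sp_sub) (auto simp: span[symmetric] Sp_def scaleR_eq_scaleC)
      then show "\<exists>z\<in>Sp (Suc n). (w j, z) \<in> J"
        using y[of j] Sp_mono[of "Suc (Suc j)" "Suc n"] \<open>j < n\<close> by auto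
    qed
    ultimately have "cvec.span (w ` {..<n}) \<subseteq> {x. \<exists>z\<in>Sp (Suc n). (x, z) \<in> J}"
      by (intro cvec.span_minimal)
    then show ?thesis
      using that unfolding Sp_def span by blast
  qed
  show dom: "v n \<in> Domain J" for n
    using J_Sp[OF v_Sp] by blast
  define A where "A n = op_apply J (v n)" for n
  have A: "(v n, A n) \<in> J" for n
    unfolding A_def by (rule op_apply_mem[OF linear_J dom])
  have A_Sp: "A n \<in> Sp (n + 2)" for n
    using J_Sp[OF v_Sp, of n] A[of n] linear_operatorD(1)[OF linear_J] by fastforce
  have orth: "cinner (v m) t = 0" if "t \<in> Sp n" "n \<le> m" for m n t
    using orthonormal_span[OF v] that unfolding Sp_def by blast
  define M where "M = matrix_representation J v"
  have M: "M k j = cinner (v k) (A j)" for k j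
    by (simp add: M_def matrix_representation_def A_def)
  have zero: "M k j = 0" if "j + 1 < k" for k j
    unfolding M using that by (intro orth[OF A_Sp]) auto
  have herm: "M k j = cnj (M j k)" for k j
    unfolding M using symmetric_J[OF A[of k] A[of j]] by (metis cinner_commute)
  \<comment> \<open>Modulo \<open>Sp (Suc j)\<close>, to which \<open>v (Suc j)\<close> is
    orthogonal, \<open>r j\<close> times \<open>A j\<close> is \<open>y j\<close>, then
    \<open>\<beta> j\<close> times \<open>w (Suc j)\<close>, then
    \<open>\<beta> j * r (Suc j)\<close> times \<open>v (Suc j)\<close>.\<close>
  have sub: "M (Suc j) j = complex_of_real (\<beta> j * r (Suc j) / r j)" for j
  proof -
    have "(w j - r j *\<^sub>R v j, y j - r j *\<^sub>R A j) \<in> J"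
      unfolding scaleR_eq_scaleC by (intro linear_operatorD(4,5)[OF linear_J] y A)
    then have "y j - r j *\<^sub>R A j \<in> Sp (Suc j)"
      using J_Sp[of "w j - r j *\<^sub>R v j" j] r(2) linear_operatorD(1)[OF linear_J]
      unfolding Sp_def by blast
    then have "cinner (v (Suc j)) (y j - r j *\<^sub>R A j) = 0"
      by (rule orth) simp
    then have 1: "cinner (v (Suc j)) (y j) = r j * M (Suc j) j"
      by (simp add: cinner_diff_right scaleR_eq_scaleC cinner_scaleC_right M)
    have "cinner (v (Suc j)) (y j - \<beta> j *\<^sub>R w (Suc j)) = 0"
      by (rule orth[of _ "Suc j"]) (use \<beta>(2) in \<open>simp_all add: Sp_def span\<close>)
    then have 2: "cinner (v (Suc j)) (y j) = \<beta> j * cinner (v (Suc j)) (w (Suc j))"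
      by (simp add: cinner_diff_right scaleR_eq_scaleC cinner_scaleC_right)
    have "cinner (v (Suc j)) (w (Suc j) - r (Suc j) *\<^sub>R v (Suc j)) = 0"
      by (rule orth[of _ "Suc j"]) (use r(2) in \<open>simp_all add: Sp_def\<close>)
    then have 3: "cinner (v (Suc j)) (w (Suc j)) = r (Suc j)"
      using v by (simp add: cinner_diff_right scaleR_eq_scaleC cinner_scaleC_right orthonormal_def)
    show ?thesis
      using 1 2 3 r(1)[of j] by (simp add: field_simps)
  qed
  define D where "D k = Re (M k k)" for k
  have diag: "M k k = complex_of_real (D k)" for k
    using herm[of k k] by (simp add: complex_eq_iff D_def)
  show "jacobi_matrix (matrix_representation J v)"
    unfolding jacobi_matrix_def M_def[symmetric]
  proof (intro exI conjI allI)
    show "0 < \<beta> k * r (Suc k) / r k" for k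
      using \<beta>(1) r(1) by simp
    fix k j
    have upper: "M k j = 0" if "k + 1 < j"
      using herm[of k j] zero[OF that] by simp
    have super: "M k (Suc k) = complex_of_real (\<beta> k * r (Suc k) / r k)"
      unfolding herm[of k "Suc k"] sub by simp
    consider "j = k" | "j = Suc k" | "k = Suc j" | "k + 1 < j" | "j + 1 < k"
      by linarith
    then show "M k j = (if j = k then complex_of_real (D k)
         else if j = k + 1 then complex_of_real (\<beta> k * r (Suc k) / r k)
         else if k = j + 1 then complex_of_real (\<beta> j * r (Suc j) / r j) else 0)"
      by cases (simp_all add: diag sub super upper zero)
  qed
qed

section \<open>Construction of a second Jacobi basis\<close>

lemma resolvent_if_selfadjoint:
  assumes "selfadjoint J" "Im z \<noteq> 0"
  obtains x v where "(x, v) \<in> J" "f = v - z *\<^sub>C x"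
proof -
  obtain x v e where xv: "(x, v) \<in> J" "f = v - z *\<^sub>C x + e" and e: "(e, cnj z *\<^sub>C e) \<in> Jmax"
    using ran_decomposition[OF assms(2), of f] by metis
  have "(e, cnj z *\<^sub>C e) \<in> J"
    using e assms(1) by (simp add: adjoint_J[symmetric] selfadjoint_def)
  \<comment> \<open>The remainder would be an eigenvector of \<open>J\<close> with a nonreal
    eigenvalue.\<close>
  from J_bounded_below[OF this, of "cnj z"] have "e = 0"
    using assms(2) by (simp add: mult_le_0_iff)
  then show thesis
    using that xv by simp
qed

lemma second_jacobi_basis:
  assumes "selfadjoint J"
  shows "\<exists>v\<in>jacobi_bases J. \<not> equal_mod_phase delta v"
proof -
  obtain g h where gh: "(g, h) \<in> J" "delta 0 = h - \<i> *\<^sub>C g"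
    using resolvent_if_selfadjoint[OF assms, of \<i>] by auto
  have h: "h = delta 0 + \<i> *\<^sub>C g"
    by (simp add: gh(2))
  have Lg: "L (coord g) (Suc k) = \<i> * coord g (Suc k)" for k
    using JmaxD[of g h "Suc k"] gh(1) J_subset_Jmax by (auto simp: h)
  \<comment> \<open>\<open>y n\<close> is the image of \<open>w n\<close>, and
    \<open>\<beta>\<close> is the Hessenberg subdiagonal: J g = delta 0 + \<i> g gives its first
    entry 1, and the rows of the matrix give the rest.\<close>
  define w where "w n = (case n of 0 \<Rightarrow> g | Suc k \<Rightarrow> delta k)" for n
  define y where "y n = (case n of 0 \<Rightarrow> h | Suc k \<Rightarrow> Jdelta k)" for n
  define \<beta> where "\<beta> n = (case n of 0 \<Rightarrow> 1 | Suc k \<Rightarrow> b k)" for n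
  have g_nz: "g \<noteq> 0"
  proof
    assume "g = 0"
    then have "h = 0"
      using gh(1) linear_operatorD(1,2)[OF linear_J] by blast
    then have "delta 0 = 0"
      using gh(2) \<open>g = 0\<close> by simp
    then show False
      using coord_delta[of 0 0] by simp
  qed
  \<comment> \<open>If the entries beyond k vanish, row k + 1 reduces to b k g k = 0.\<close>
  have no_finite_support: "coord g k = 0" if "\<And>j. k < j \<Longrightarrow> coord g j = 0" for k
    using Lg[of k] that[of "Suc k"] that[of "Suc (Suc k)"] by (simp add: L_def)
  have indep: "w n \<notin> cvec.span (w ` {..<n})" for n
  proof (cases n)
    case (Suc k)
    \<comment> \<open>From coordinate k on, \<open>g, delta 0, ..., delta (k - 1)\<close> are all
      multiples of \<open>g\<close>. For \<open>delta k\<close> this would make \<open>g\<close>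
      vanish beyond k, hence also at k, where the multiple has to be 1.\<close>
    have "cvec.span (w ` {..<Suc k}) \<subseteq> {t. \<exists>c. \<forall>j\<ge>k. coord t j = c * coord g j}"
    proof (rule cvec.span_minimal)
      show "w ` {..<Suc k} \<subseteq> {t. \<exists>c. \<forall>j\<ge>k. coord t j = c * coord g j}"
      proof clarify
        fix i assume "i < Suc k"
        then show "\<exists>c. \<forall>j\<ge>k. coord (w i) j = c * coord g j"
          by (cases i) (auto simp: w_def intro: exI[of _ 1] exI[of _ 0])
      qed
      show "cvec.subspace {t. \<exists>c. \<forall>j\<ge>k. coord t j = c * coord g j}"
        unfolding cvec.subspace_def
      proof (intro conjI ballI allI)
        show "0 \<in> {t. \<exists>c. \<forall>j\<ge>k. coord t j = c * coord g j}"
          by (auto intro: exI[of _ 0])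
      next
        fix x y
        assume "x \<in> {t. \<exists>c. \<forall>j\<ge>k. coord t j = c * coord g j}" "y \<in> {t. \<exists>c. \<forall>j\<ge>k. coord t j = c * coord g j}"
        then obtain c d where "\<forall>j\<ge>k. coord x j = c * coord g j" "\<forall>j\<ge>k. coord y j = d * coord g j"
          by blast
        then show "x + y \<in> {t. \<exists>c. \<forall>j\<ge>k. coord t j = c * coord g j}"
          by (auto intro!: exI[of _ "c + d"] simp: distrib_right)
      next
        fix d x
        assume "x \<in> {t. \<exists>c. \<forall>j\<ge>k. coord t j = c * coord g j}"
        then obtain c where "\<forall>j\<ge>k. coord x j = c * coord g j"
          by blast
        then show "d *\<^sub>C x \<in> {t. \<exists>c. \<forall>j\<ge>k. coord t j = c * coord g j}"
          by (auto intro!: exI[of _ "d * c"])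
      qed
    qed
    moreover have "delta k \<notin> {t. \<exists>c. \<forall>j\<ge>k. coord t j = c * coord g j}"
    proof clarify
      fix c assume c: "\<forall>j\<ge>k. coord (delta k) j = c * coord g j"
      then have k: "1 = c * coord g k"
        by (metis coord_delta order_refl)
      have "c * coord g j = 0" if "k < j" for j
        using c that by (metis coord_delta less_imp_le less_irrefl)
      moreover have "c \<noteq> 0"
        using k by auto
      ultimately have "coord g k = 0"
        using no_finite_support[of k] by auto
      then show False
        using k by simp
    qed
    ultimately have "delta k \<notin> cvec.span (w ` {..<Suc k})"
      by blast
    moreover have "w n = delta k"
      by (simp add: Suc w_def)
    ultimately show ?thesis
      by (simp add: Suc)
  qed (simp add: w_def g_nz)
  define v where "v = gram_schmidt w"
  have v: "orthonormal v"
    unfolding v_def by (rule orthonormal_gram_schmidt[OF indep])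
  have span: "cvec.span (v ` {..<n}) = cvec.span (w ` {..<n})" for n
    unfolding v_def using gram_schmidt_span_residue[OF indep] by blast
  obtain r where r: "\<And>n. 0 < r n" "\<And>n. w n - r n *\<^sub>R v n \<in> cvec.span (v ` {..<n})"
    unfolding v_def using gram_schmidt_span_residue[OF indep] by metis
  have y: "(w n, y n) \<in> J" for n
    unfolding w_def y_def by (cases n) (simp_all add: gh(1) delta_Jdelta)
  have \<beta>: "0 < \<beta> n" for n
    unfolding \<beta>_def by (cases n) (simp_all add: b_pos)
  have \<beta>': "y n - \<beta> n *\<^sub>R w (Suc n) \<in> cvec.span (w ` {..<Suc n})" for n
  proof (cases n)
    case 0
    have "g \<in> cvec.span (w ` {..<1})"
      by (intro cvec.span_base) (auto simp: w_def)
    then show ?thesis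
      unfolding 0 y_def \<beta>_def w_def by (simp add: h cvec.span_scale)
  next
    case (Suc k)
    have "delta j \<in> cvec.span (w ` {..<Suc (Suc k)})" if "j \<le> k" for j
      using that by (intro cvec.span_base image_eqI[of _ _ "Suc j"]) (auto simp: w_def)
    then have "(if k = 0 then 0 else complex_of_real (b (k - 1)) *\<^sub>C delta (k - 1))
        + complex_of_real (q k) *\<^sub>C delta k \<in> cvec.span (w ` {..<Suc (Suc k)})"
      by (auto intro!: cvec.span_add cvec.span_scale cvec.span_zero)
    moreover have "y n - \<beta> n *\<^sub>R w (Suc n) = (if k = 0 then 0 else complex_of_real (b (k - 1)) *\<^sub>C delta (k - 1))
        + complex_of_real (q k) *\<^sub>C delta k"
      by (simp add: Suc y_def \<beta>_def w_def Jdelta_def scaleR_eq_scaleC)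
    ultimately show ?thesis
      by (simp add: Suc)
  qed
  note * = jacobi_matrix_if_hessenberg[OF v span r y \<beta> \<beta>']
  have delta: "delta k \<in> cvec.span (v ` {..<k + 2})" for k
    unfolding span by (intro cvec.span_base image_eqI[of _ _ "Suc k"]) (auto simp: w_def)
  have "delta k \<in> cvec.span (range v)" for k
    using delta[of k] cvec.span_mono[of "v ` {..<k + 2}" "range v"] by blast
  then have "v \<in> jacobi_bases J"
    unfolding jacobi_bases_def using *
    by (auto intro!: basis_of_representation_J orthonormal_basis_if_delta_in_span v delta)
  moreover have "\<not> equal_mod_phase delta v"
  proof
    assume "equal_mod_phase delta v"
    then obtain c where c: "v 0 = c *\<^sub>C delta 0"
      by (auto simp: equal_mod_phase_def)
    \<comment> \<open>The first residue lies in the span of the empty set, so \<open>g\<close> would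
      be a multiple of \<open>delta 0\<close>.\<close>
    have "g = r 0 *\<^sub>R v 0"
      using r(2)[of 0] by (simp add: w_def)
    then have "coord g j = 0" if "0 < j" for j
      using that by (simp add: c)
    moreover from this have "coord g 0 = 0"
      by (rule no_finite_support)
    ultimately have "g = 0"
      by (intro ell2_eqI) (metis coord_zero gr0I)
    then show False
      using g_nz by simp
  qed
  ultimately show ?thesis
    by blast
qed

end


section \<open>Uniqueness in the limit circle case\<close>

text \<open>The growth bound separates z from k. Since 2 |f| a \<le> |f|^2 + a^2, the products |f k|
  a k are summable and dominate the series on bounded sets; the factor in z gives minimal
  type.\<close>

lemma entire_pairing:
  fixes s :: "complex \<Rightarrow> nat \<Rightarrow> complex" and f :: "nat \<Rightarrow> complex" and a :: "nat \<Rightarrow> real"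
  assumes hol: "\<And>k. (\<lambda>z. s z k) holomorphic_on UNIV"
    and growth: "\<And>e. 0 < e \<Longrightarrow> \<exists>C\<ge>0. \<forall>z k. cmod (s z k) \<le> C * exp (e * cmod z) * a k"
    and a: "\<And>k. 0 \<le> a k" "summable (\<lambda>k. (a k)\<^sup>2)" and f: "summable (\<lambda>k. (cmod (f k))\<^sup>2)"
  shows "(\<lambda>z. \<Sum>k. f k * s z k) holomorphic_on UNIV"
    and "0 < e \<Longrightarrow> \<exists>C. \<forall>z. cmod (\<Sum>k. f k * s z k) \<le> C * exp (e * cmod z)"
proof -
  have fa: "summable (\<lambda>k. cmod (f k) * a k)"
  proof (rule summable_comparison_test'[where N = 0])
    show "summable (\<lambda>k. (cmod (f k))\<^sup>2 + (a k)\<^sup>2)"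
      by (intro summable_add f a)
    fix k
    have "2 * (cmod (f k) * a k) \<le> (cmod (f k))\<^sup>2 + (a k)\<^sup>2"
      using sum_squares_bound[of "cmod (f k)" "a k"] by simp
    moreover have "0 \<le> cmod (f k) * a k"
      using a(1) by simp
    ultimately show "norm (cmod (f k) * a k) \<le> (cmod (f k))\<^sup>2 + (a k)\<^sup>2"
      by simp
  qed
  have term_le: "cmod (f k * s z k) \<le> C * exp (e * cmod z) * (cmod (f k) * a k)"
    if "\<forall>z k. cmod (s z k) \<le> C * exp (e * cmod z) * a k" for C e z k
  proof -
    have "cmod (f k) * cmod (s z k) \<le> cmod (f k) * (C * exp (e * cmod z) * a k)"
      using that by (intro mult_left_mono) auto
    then show ?thesis
      by (simp add: norm_mult mult_ac)
  qed
  show "(\<lambda>z. \<Sum>k. f k * s z k) holomorphic_on UNIV"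
  proof (rule entire_suminf)
    show "(\<lambda>z. f k * s z k) holomorphic_on UNIV" for k
      by (intro holomorphic_intros hol)
    fix R
    obtain C where C: "0 \<le> C" "\<forall>z k. cmod (s z k) \<le> C * exp (1 * cmod z) * a k"
      using growth[of 1] by auto
    have "cmod (f k * s z k) \<le> C * exp R * (cmod (f k) * a k)" if "cmod z \<le> R" for k z
      by (rule order_trans[OF term_le[OF C(2)]])
        (intro mult_right_mono mult_left_mono mult_nonneg_nonneg, use C(1) a(1) that in auto)
    moreover have "summable (\<lambda>k. C * exp R * (cmod (f k) * a k))"
      by (intro summable_mult fa)
    ultimately show "\<exists>M. summable M \<and> (\<forall>k z. cmod z \<le> R \<longrightarrow> cmod (f k * s z k) \<le> M k)"
      by blast
  qed
  show "\<exists>C. \<forall>z. cmod (\<Sum>k. f k * s z k) \<le> C * exp (e * cmod z)" if "0 < e"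
  proof -
    obtain C where C: "\<forall>z k. cmod (s z k) \<le> C * exp (e * cmod z) * a k"
      using growth[OF \<open>0 < e\<close>] by auto
    have "cmod (\<Sum>k. f k * s z k) \<le> (C * (\<Sum>k. cmod (f k) * a k)) * exp (e * cmod z)" for z
    proof -
      have "cmod (\<Sum>k. f k * s z k) \<le> (\<Sum>k. C * exp (e * cmod z) * (cmod (f k) * a k))"
        by (rule norm_suminf_le[OF term_le[OF C]]) (intro summable_mult fa)
      also have "\<dots> = C * exp (e * cmod z) * (\<Sum>k. cmod (f k) * a k)"
        by (rule suminf_mult[OF fa])
      finally show ?thesis
        by (simp add: mult_ac)
    qed
    then show ?thesis
      by blast
  qed
qed

section \<open>Square summability of the solutions at \<i>\<close>

context jacobi
begin

text \<open>By \<open>eigen_unique\<close>, \<open>e\<close> is a nonzero multiple of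
  \<open>P z\<close>; real coefficients carry the result to the conjugate point.\<close>

lemma P_square_summable_if_eigenvector:
  assumes "(e, z *\<^sub>C e) \<in> Jmax" "e \<noteq> 0"
  shows "summable (\<lambda>k. (cmod (P z k))\<^sup>2)" "summable (\<lambda>k. (cmod (P (cnj z) k))\<^sup>2)"
proof -
  have e: "coord e k = coord e 0 * P z k" for k
    using JmaxD[OF assms(1)] by (intro eigen_unique) simp
  have "coord e 0 \<noteq> 0"
  proof
    assume "coord e 0 = 0"
    then have "e = 0"
      by (intro ell2_eqI) (subst e, simp)
    then show False
      using assms(2) by simp
  qed
  then have "P z k = (1 / coord e 0) * coord e k" for k
    unfolding e[of k] by simp
  then show "summable (\<lambda>k. (cmod (P z k))\<^sup>2)"
    using ell2_scale_summable[OF coord_summable[of e], of "1 / coord e 0"] by simp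
  then show "summable (\<lambda>k. (cmod (P (cnj z) k))\<^sup>2)"
    by (simp add: P_cnj)
qed

text \<open>Otherwise \<open>Jmax\<close> has no eigenvectors at \<i> and -\<i>. Absence at -\<i>
  makes the range of J - \<i> everything, so each element of \<open>Jmax\<close> has a partner in
  \<open>J\<close> with the same image; absence at \<i> makes the two equal.\<close>

lemma P_square_summable_if_not_selfadjoint:
  assumes "\<not> selfadjoint J"
  shows "summable (\<lambda>k. (cmod (P \<i> k))\<^sup>2)"
proof (rule ccontr)
  assume not: "\<not> summable (\<lambda>k. (cmod (P \<i> k))\<^sup>2)"
  have eigen: "e = 0" if "(e, z *\<^sub>C e) \<in> Jmax" "z = \<i> \<or> z = - \<i>" for e z
  proof (rule ccontr)
    assume "e \<noteq> 0"
    from P_square_summable_if_eigenvector[OF that(1) this] show False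
      using that(2) not by auto
  qed
  have "Jmax \<subseteq> J"
  proof clarify
    fix y w assume yw: "(y, w) \<in> Jmax"
    have i: "Im \<i> \<noteq> 0"
      by simp
    obtain x v e where xv: "(x, v) \<in> J" "w - \<i> *\<^sub>C y = v - \<i> *\<^sub>C x + e" and e: "(e, cnj \<i> *\<^sub>C e) \<in> Jmax"
      using ran_decomposition[of \<i> "w - \<i> *\<^sub>C y", OF i] by metis
    have "e = 0"
      by (rule eigen[OF e]) simp
    then have "w - v = \<i> *\<^sub>C (y - x)"
      using xv(2) by (simp add: cvec.scale_right_diff_distrib algebra_simps)
    moreover have "(y - x, w - v) \<in> Jmax"
      using linear_operatorD(5)[OF linear_Jmax yw] xv(1) J_subset_Jmax by blast
    ultimately have "y - x = 0" "w - v = 0"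
      using eigen[of "y - x" \<i>] by auto
    then show "(y, w) \<in> J"
      using xv(1) by simp
  qed
  then have "selfadjoint J"
    using J_subset_Jmax by (auto simp: selfadjoint_def linear_J closure_Domain_J adjoint_J)
  then show False
    using assms by simp
qed

text \<open>Some square summable \<open>y\<close> solves the same inhomogeneous equation as
  \<open>Q \<i>\<close>, and two solutions differ by a multiple of \<open>P \<i>\<close>.\<close>

lemma Q_square_summable_if_P:
  assumes P: "summable (\<lambda>k. (cmod (P \<i> k))\<^sup>2)"
  shows "summable (\<lambda>k. (cmod (Q \<i> k))\<^sup>2)"
proof -
  have "Im \<i> \<noteq> 0"
    by simp
  from ran_decomposition[of \<i> "delta 0", OF this]
  obtain x v e where xv: "(x, v) \<in> J" "delta 0 = v - \<i> *\<^sub>C x + e" and e: "(e, cnj \<i> *\<^sub>C e) \<in> Jmax"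
    by metis
  \<comment> \<open>\<open>Jmax - \<i>\<close> multiplies \<open>e\<close> by -2 \<i>; the
    coefficient \<i> / 2 turns this into \<open>e\<close>, the part of \<open>delta 0\<close> missed
    by the range.\<close>
  define y where "y = x + (\<i> / 2) *\<^sub>C e"
  have "(y, v + (\<i> / 2) *\<^sub>C (cnj \<i> *\<^sub>C e)) \<in> Jmax"
    unfolding y_def using xv(1) J_subset_Jmax by (intro linear_operatorD(3,4)[OF linear_Jmax] e) blast
  from JmaxD[OF this] have "L (coord y) k = \<i> * coord y k + (coord v k - \<i> * coord x k + coord e k)" for k
    by (simp add: y_def algebra_simps)
  moreover have "coord v k - \<i> * coord x k + coord e k = coord (delta 0) k" for k
    by (simp add: xv(2))
  ultimately have Ly: "L (coord y) k = \<i> * coord y k + (if k = 0 then 1 else 0)" for k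
    by simp
  have "L (\<lambda>k. coord y k - Q \<i> k) k = \<i> * (coord y k - Q \<i> k)" for k
  proof -
    have "L (\<lambda>k. coord y k - Q \<i> k) k = L (coord y) k - L (Q \<i>) k"
      by (simp add: L_def algebra_simps)
    then show ?thesis
      by (simp add: Ly L_Q algebra_simps)
  qed
  then have "coord y k - Q \<i> k = (coord y 0 - Q \<i> 0) * P \<i> k" for k
    by (rule eigen_unique)
  then have "Q \<i> k = coord y k + (- coord y 0) * P \<i> k" for k
    by (metis Q_0 add.commute diff_add_cancel diff_zero minus_diff_eq minus_mult_left uminus_add_conv_diff)
  then show ?thesis
    using ell2_add_summable[OF coord_summable[of y] ell2_scale_summable[OF P, of "- coord y 0"]] by simp
qed

section \<open>Growth of the solutions in the spectral parameter\<close>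

lemma wronskian: "b k * (P z k * Q z (Suc k) - P z (Suc k) * Q z k) = 1"
proof (induction k)
  case 0
  show ?case
    by (simp add: P_def Q_def)
next
  case (Suc k)
  have "b (Suc k) * (P z (Suc k) * Q z (Suc (Suc k)) - P z (Suc (Suc k)) * Q z (Suc k))
     = P z (Suc k) * (b (Suc k) * Q z (Suc (Suc k))) - (b (Suc k) * P z (Suc (Suc k))) * Q z (Suc k)"
    by (simp add: algebra_simps)
  \<comment> \<open>Inserting the recurrence cancels the diagonal terms, so the Wronskian does not
    depend on k.\<close>
  also have "\<dots> = b k * (P z k * Q z (Suc k) - P z (Suc k) * Q z k)"
    unfolding P_def Q_def sol_Suc_Suc by (simp add: algebra_simps)
  finally show ?case
    using Suc by simp
qed

text \<open>It carries the dependence on k, outside the product, of the growth bounds at all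
  z.\<close>

definition majorant :: "nat \<Rightarrow> real" where
  "majorant k = cmod (P \<i> k) + cmod (Q \<i> k)"

lemma majorant_nonneg: "0 \<le> majorant k"
  by (simp add: majorant_def)

text \<open>Variation of constants: write a solution at \<open>z\<close> as a combination of the two solutions at
  \<open>\<i>\<close>. The coefficients are the Wronskians \<open>\<alpha>\<close>, \<open>\<beta>\<close>, which change in each step by an amount
  proportional to \<open>z - \<i>\<close>.\<close>

lemma sol_growth:
  fixes z s0 s1 :: complex
  defines "s \<equiv> sol z s0 s1"
  defines "\<alpha> \<equiv> \<lambda>k. b k * (s k * Q \<i> (Suc k) - s (Suc k) * Q \<i> k)"
    and "\<beta> \<equiv> \<lambda>k. b k * (P \<i> k * s (Suc k) - P \<i> (Suc k) * s k)"
  shows "cmod (s k) \<le> (cmod (\<alpha> 0) + cmod (\<beta> 0))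
    * (\<Prod>j<k. 1 + cmod (z - \<i>) * (majorant (Suc j))\<^sup>2) * majorant k"
proof -
  \<comment> \<open>Cramer's rule for the entries k and k + 1; the determinant is the Wronskian
    1.\<close>
  have comb: "s k = \<alpha> k * P \<i> k + \<beta> k * Q \<i> k" "s (Suc k) = \<alpha> k * P \<i> (Suc k) + \<beta> k * Q \<i> (Suc k)" for k
  proof -
    have "\<alpha> k * P \<i> k + \<beta> k * Q \<i> k = (b k * (P \<i> k * Q \<i> (Suc k) - P \<i> (Suc k) * Q \<i> k)) * s k"
      "\<alpha> k * P \<i> (Suc k) + \<beta> k * Q \<i> (Suc k) = (b k * (P \<i> k * Q \<i> (Suc k) - P \<i> (Suc k) * Q \<i> k)) * s (Suc k)"
      by (simp_all add: \<alpha>_def \<beta>_def algebra_simps)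
    then show "s k = \<alpha> k * P \<i> k + \<beta> k * Q \<i> k" "s (Suc k) = \<alpha> k * P \<i> (Suc k) + \<beta> k * Q \<i> (Suc k)"
      unfolding wronskian by simp_all
  qed
  have le_maj: "cmod (x * P \<i> k + y * Q \<i> k) \<le> (cmod x + cmod y) * majorant k" for x y k
  proof -
    have "cmod (x * P \<i> k + y * Q \<i> k) \<le> cmod x * cmod (P \<i> k) + cmod y * cmod (Q \<i> k)"
      by (rule norm_triangle_le) (simp add: norm_mult)
    also have "\<dots> \<le> (cmod x + cmod y) * majorant k"
      unfolding majorant_def by (simp add: algebra_simps)
    finally show ?thesis .
  qed
  have step_\<alpha>: "\<alpha> (Suc k) = \<alpha> k - (z - \<i>) * s (Suc k) * Q \<i> (Suc k)" for k
  proof -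
    have "\<alpha> (Suc k) = s (Suc k) * (b (Suc k) * Q \<i> (Suc (Suc k))) - (b (Suc k) * s (Suc (Suc k))) * Q \<i> (Suc k)"
      unfolding \<alpha>_def by (simp add: algebra_simps)
    then show ?thesis
      unfolding Q_def s_def sol_Suc_Suc unfolding \<alpha>_def Q_def s_def by (simp add: algebra_simps)
  qed
  have step_\<beta>: "\<beta> (Suc k) = \<beta> k + (z - \<i>) * s (Suc k) * P \<i> (Suc k)" for k
  proof -
    have "\<beta> (Suc k) = P \<i> (Suc k) * (b (Suc k) * s (Suc (Suc k))) - (b (Suc k) * P \<i> (Suc (Suc k))) * s (Suc k)"
      unfolding \<beta>_def by (simp add: algebra_simps)
    then show ?thesis
      unfolding P_def s_def sol_Suc_Suc unfolding \<beta>_def P_def s_def by (simp add: algebra_simps)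
  qed
  \<comment> \<open>The entry \<open>s (Suc k)\<close> in both increments is itself a combination
    with the coefficients at k, which closes the recursion.\<close>
  have step: "cmod (\<alpha> (Suc k)) + cmod (\<beta> (Suc k))
      \<le> (cmod (\<alpha> k) + cmod (\<beta> k)) * (1 + cmod (z - \<i>) * (majorant (Suc k))\<^sup>2)" for k
  proof -
    have "cmod (\<alpha> (Suc k)) \<le> cmod (\<alpha> k) + cmod (z - \<i>) * cmod (s (Suc k)) * cmod (Q \<i> (Suc k))"
      unfolding step_\<alpha> by (rule norm_triangle_le_diff) (simp add: norm_mult)
    moreover have "cmod (\<beta> (Suc k)) \<le> cmod (\<beta> k) + cmod (z - \<i>) * cmod (s (Suc k)) * cmod (P \<i> (Suc k))"
      unfolding step_\<beta> by (rule norm_triangle_le) (simp add: norm_mult)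
    ultimately have "cmod (\<alpha> (Suc k)) + cmod (\<beta> (Suc k))
        \<le> cmod (\<alpha> k) + cmod (\<beta> k) + cmod (z - \<i>) * majorant (Suc k) * cmod (s (Suc k))"
      by (simp add: majorant_def algebra_simps)
    also have "\<dots> \<le> cmod (\<alpha> k) + cmod (\<beta> k)
        + cmod (z - \<i>) * majorant (Suc k) * ((cmod (\<alpha> k) + cmod (\<beta> k)) * majorant (Suc k))"
      unfolding comb(2)[of k]
      by (intro add_left_mono mult_left_mono le_maj) (simp_all add: majorant_nonneg)
    finally show ?thesis
      by (simp add: power2_eq_square algebra_simps)
  qed
  have prod: "cmod (\<alpha> k) + cmod (\<beta> k)
      \<le> (cmod (\<alpha> 0) + cmod (\<beta> 0)) * (\<Prod>j<k. 1 + cmod (z - \<i>) * (majorant (Suc j))\<^sup>2)" for k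
  proof (induction k)
    case (Suc k)
    have "cmod (\<alpha> (Suc k)) + cmod (\<beta> (Suc k))
        \<le> ((cmod (\<alpha> 0) + cmod (\<beta> 0)) * (\<Prod>j<k. 1 + cmod (z - \<i>) * (majorant (Suc j))\<^sup>2))
          * (1 + cmod (z - \<i>) * (majorant (Suc k))\<^sup>2)"
      by (rule order_trans[OF step mult_right_mono[OF Suc]]) simp
    then show ?case
      by (simp add: mult.assoc)
  qed simp
  have "cmod (s k) \<le> (cmod (\<alpha> k) + cmod (\<beta> k)) * majorant k"
    unfolding comb(1)[of k] by (rule le_maj)
  also have "\<dots> \<le> (cmod (\<alpha> 0) + cmod (\<beta> 0))
      * (\<Prod>j<k. 1 + cmod (z - \<i>) * (majorant (Suc j))\<^sup>2) * majorant k"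
    by (intro mult_right_mono prod majorant_nonneg)
  finally show ?thesis .
qed

text \<open>The initial Wronskians are 1 and z - \<i> for \<open>P\<close>, 0 and 1 for
  \<open>Q\<close>, so the factor 1 + |z - \<i>| serves both.\<close>

lemma PQ_growth:
  fixes z :: complex and k :: nat
  defines "B \<equiv> (1 + cmod (z - \<i>)) * (\<Prod>j<k. 1 + cmod (z - \<i>) * (majorant (Suc j))\<^sup>2) * majorant k"
  shows "cmod (P z k) \<le> B" "cmod (Q z k) \<le> B"
proof -
  have P\<beta>: "complex_of_real (b 0) * (P \<i> 0 * P z (Suc 0) - P \<i> (Suc 0) * P z 0) = z - \<i>"
    by (simp add: P_def field_simps)
  have Q\<alpha>: "complex_of_real (b 0) * (Q z 0 * Q \<i> (Suc 0) - Q z (Suc 0) * Q \<i> 0) = 0"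
    and Q\<beta>: "complex_of_real (b 0) * (P \<i> 0 * Q z (Suc 0) - P \<i> (Suc 0) * Q z 0) = 1"
    and P\<alpha>: "complex_of_real (b 0) * (P z 0 * Q \<i> (Suc 0) - P z (Suc 0) * Q \<i> 0) = 1"
    by (simp_all, simp_all add: Q_def)
  show "cmod (P z k) \<le> B"
    using sol_growth[of z 1 "(z - complex_of_real (q 0)) / complex_of_real (b 0)" k]
    unfolding P_def[of z, symmetric] P\<alpha> P\<beta> B_def by simp
  have "0 \<le> (\<Prod>j<k. 1 + cmod (z - \<i>) * (majorant (Suc j))\<^sup>2) * majorant k"
    by (intro mult_nonneg_nonneg prod_nonneg majorant_nonneg) simp
  then have "1 * ((\<Prod>j<k. 1 + cmod (z - \<i>) * (majorant (Suc j))\<^sup>2) * majorant k) \<le> B"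
    unfolding B_def mult.assoc by (intro mult_right_mono) simp_all
  moreover have "cmod (Q z k) \<le> (\<Prod>j<k. 1 + cmod (z - \<i>) * (majorant (Suc j))\<^sup>2) * majorant k"
    using sol_growth[of z 0 "1 / complex_of_real (b 0)" k]
    unfolding Q_def[of z, symmetric] Q\<alpha> Q\<beta> by simp
  ultimately show "cmod (Q z k) \<le> B"
    by simp
qed

lemma sol_holomorphic:
  assumes "s0 holomorphic_on UNIV" "s1 holomorphic_on UNIV"
  shows "(\<lambda>z. sol z (s0 z) (s1 z) k) holomorphic_on UNIV"
proof -
  have "(\<lambda>z. sol z (s0 z) (s1 z) k) holomorphic_on UNIV
      \<and> (\<lambda>z. sol z (s0 z) (s1 z) (Suc k)) holomorphic_on UNIV"
  proof (induction k)
    case (Suc k)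
    then show ?case
      by (auto intro!: holomorphic_intros)
  qed (simp add: assms)
  then show ?thesis ..
qed

lemma P_holomorphic: "(\<lambda>z. P z k) holomorphic_on UNIV"
  unfolding P_def by (intro sol_holomorphic holomorphic_intros) auto

lemma Q_holomorphic: "(\<lambda>z. Q z k) holomorphic_on UNIV"
  unfolding Q_def by (intro sol_holomorphic holomorphic_intros)

end

text \<open>By \<open>P_square_summable_if_not_selfadjoint\<close> this covers every nonselfadjoint
  \<open>J\<close>. Square summability at the other points is derived from \<i>.\<close>

locale limit_circle = jacobi +
  assumes P_square_summable_i: "summable (\<lambda>k. (cmod (P \<i> k))\<^sup>2)"
begin

lemma majorant_square_summable: "summable (\<lambda>k. (majorant k)\<^sup>2)"
proof (rule summable_comparison_test'[where N = 0])
  show "summable (\<lambda>k. 2 * (cmod (P \<i> k))\<^sup>2 + 2 * (cmod (Q \<i> k))\<^sup>2)"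
    by (intro summable_add summable_mult P_square_summable_i Q_square_summable_if_P)
  show "norm ((majorant k)\<^sup>2) \<le> 2 * (cmod (P \<i> k))\<^sup>2 + 2 * (cmod (Q \<i> k))\<^sup>2" for k
    using sum_squares_bound[of "cmod (P \<i> k)" "cmod (Q \<i> k)"]
    by (simp add: majorant_def power2_sum)
qed

lemma PQ_minimal_type:
  assumes "0 < e"
  shows "\<exists>C\<ge>0. \<forall>z k. cmod (P z k) \<le> C * exp (e * cmod z) * majorant k
    \<and> cmod (Q z k) \<le> C * exp (e * cmod z) * majorant k"
proof -
  \<comment> \<open>The leading 1 absorbs the prefactor 1 + |z - \<i>| into the product as its first
    factor.\<close>
  define a where "a j = (case j of 0 \<Rightarrow> 1 | Suc j \<Rightarrow> (majorant (Suc j))\<^sup>2)" for j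
  have "summable (\<lambda>j. a (Suc j))"
    using majorant_square_summable by (simp add: a_def summable_Suc_iff[of "\<lambda>j. (majorant j)\<^sup>2"])
  then have "summable a"
    by (simp add: summable_Suc_iff)
  moreover have "0 \<le> a j" for j
    by (simp add: a_def split: nat.split)
  ultimately obtain C where C: "0 \<le> C" "\<And>r n. 0 \<le> r \<Longrightarrow> (\<Prod>j<n. 1 + r * a j) \<le> C * exp (e * r)"
    using prod_minimal_type[of a e] assms by blast
  have *: "(1 + cmod (z - \<i>)) * (\<Prod>j<k. 1 + cmod (z - \<i>) * (majorant (Suc j))\<^sup>2) * majorant k
      \<le> C * exp e * exp (e * cmod z) * majorant k" for z k
  proof (rule mult_right_mono[OF _ majorant_nonneg])
    have "(1 + cmod (z - \<i>)) * (\<Prod>j<k. 1 + cmod (z - \<i>) * (majorant (Suc j))\<^sup>2)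
        = (\<Prod>j<Suc k. 1 + cmod (z - \<i>) * a j)"
      by (simp add: prod.lessThan_Suc_shift a_def del: prod.lessThan_Suc)
    also have "\<dots> \<le> C * exp (e * cmod (z - \<i>))"
      by (rule C) simp
    also have "\<dots> \<le> C * exp (e * (1 + cmod z))"
      using norm_triangle_ineq4[of z \<i>] assms C(1)
      by (intro mult_left_mono iffD2[OF exp_le_cancel_iff]) (simp_all add: add.commute)
    finally show "(1 + cmod (z - \<i>)) * (\<Prod>j<k. 1 + cmod (z - \<i>) * (majorant (Suc j))\<^sup>2)
        \<le> C * exp e * exp (e * cmod z)"
      by (simp add: distrib_left exp_add mult.assoc)
  qed
  show ?thesis
    using C(1) order_trans[OF PQ_growth(1) *] order_trans[OF PQ_growth(2) *]
    by (intro exI[of _ "C * exp e"]) simp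
qed

lemma PQ_square_summable:
  "summable (\<lambda>k. (cmod (P z k))\<^sup>2)" "summable (\<lambda>k. (cmod (Q z k))\<^sup>2)"
proof -
  obtain C where C: "0 \<le> C" "\<forall>z k. cmod (P z k) \<le> C * exp (1 * cmod z) * majorant k
    \<and> cmod (Q z k) \<le> C * exp (1 * cmod z) * majorant k"
    using PQ_minimal_type[of 1] by auto
  have *: "summable (\<lambda>k. (cmod (s k))\<^sup>2)" if "\<And>k. cmod (s k) \<le> C * exp (1 * cmod z) * majorant k"
    for s :: "nat \<Rightarrow> complex"
  proof (rule summable_comparison_test'[where N = 0])
    show "summable (\<lambda>k. (C * exp (1 * cmod z))\<^sup>2 * (majorant k)\<^sup>2)"
      by (intro summable_mult majorant_square_summable)
    show "norm ((cmod (s k))\<^sup>2) \<le> (C * exp (1 * cmod z))\<^sup>2 * (majorant k)\<^sup>2" for k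
      using power_mono[OF that[of k] norm_ge_zero, of 2] by (simp add: power_mult_distrib)
  qed
  show "summable (\<lambda>k. (cmod (P z k))\<^sup>2)" "summable (\<lambda>k. (cmod (Q z k))\<^sup>2)"
    by (rule *; use C(2) in blast)+
qed

section \<open>Totality of the square summable eigenvectors\<close>

definition \<xi> :: "complex \<Rightarrow> ell2" where "\<xi> z = Abs_ell2 (P z)"

definition \<eta> :: "complex \<Rightarrow> ell2" where "\<eta> z = Abs_ell2 (Q z)"

lemma coord_\<xi> [simp]: "coord (\<xi> z) k = P z k" and coord_\<eta> [simp]: "coord (\<eta> z) k = Q z k"
  by (simp_all add: \<xi>_def \<eta>_def coord_Abs PQ_square_summable)

lemma \<xi>_Jmax: "(\<xi> z, z *\<^sub>C \<xi> z) \<in> Jmax"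
proof -
  have "coord (\<xi> z) = P z"
    by (rule ext) simp
  then show ?thesis
    by (simp add: Jmax_def L_P)
qed

lemma \<eta>_Jmax: "(\<eta> z, z *\<^sub>C \<eta> z + delta 0) \<in> Jmax"
proof -
  have "coord (\<eta> z) = Q z"
    by (rule ext) simp
  then show ?thesis
    by (simp add: Jmax_def L_Q)
qed

lemma entire_pairing_PQ:
  assumes "summable (\<lambda>k. (cmod (f k))\<^sup>2)"
  shows "(\<lambda>z. \<Sum>k. f k * P z k) holomorphic_on UNIV" "(\<lambda>z. \<Sum>k. f k * Q z k) holomorphic_on UNIV"
    "0 < e \<Longrightarrow> \<exists>C. \<forall>z. cmod (\<Sum>k. f k * P z k) \<le> C * exp (e * cmod z)"
proof -
  have growth: "\<exists>C\<ge>0. \<forall>z k. cmod (P z k) \<le> C * exp (e * cmod z) * majorant k"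
    "\<exists>C\<ge>0. \<forall>z k. cmod (Q z k) \<le> C * exp (e * cmod z) * majorant k" if "0 < e" for e
    using PQ_minimal_type[OF that] by blast+
  show "(\<lambda>z. \<Sum>k. f k * P z k) holomorphic_on UNIV"
    by (rule entire_pairing(1)[OF P_holomorphic growth(1) majorant_nonneg majorant_square_summable assms])
  show "(\<lambda>z. \<Sum>k. f k * Q z k) holomorphic_on UNIV"
    by (rule entire_pairing(1)[OF Q_holomorphic growth(2) majorant_nonneg majorant_square_summable assms])
  show "\<exists>C. \<forall>z. cmod (\<Sum>k. f k * P z k) \<le> C * exp (e * cmod z)" if "0 < e"
    by (rule entire_pairing(2)[OF P_holomorphic growth(1) majorant_nonneg majorant_square_summable assms that])
qed

text \<open>The remainder \<open>e\<close> is a multiple of \<open>\<xi> (cnj z)\<close>, hence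
  orthogonal to \<open>f\<close>. It is orthogonal to the range component as well, thus to
  itself.\<close>

lemma resolvent_if_orthogonal:
  assumes f: "\<And>z. cinner f (\<xi> z) = 0" and z: "Im z \<noteq> 0"
  obtains x v where "(x, v) \<in> J" "f = v - z *\<^sub>C x"
proof -
  obtain x v e where xv: "(x, v) \<in> J" "f = v - z *\<^sub>C x + e" and e: "(e, cnj z *\<^sub>C e) \<in> Jmax"
    and orth: "cinner (v - z *\<^sub>C x) e = 0"
    using ran_decomposition[OF z, of f] by metis
  have "coord e k = coord e 0 * P (cnj z) k" for k
    using JmaxD[OF e] by (intro eigen_unique) simp
  then have "coord e k = coord (coord e 0 *\<^sub>C \<xi> (cnj z)) k" for k
    unfolding coord_scaleC coord_\<xi> .
  then have "e = coord e 0 *\<^sub>C \<xi> (cnj z)"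
    by (rule ell2_eqI)
  then have "cinner f e = coord e 0 * cinner f (\<xi> (cnj z))"
    by (metis cinner_scaleC_right)
  then have "cinner (v - z *\<^sub>C x + e) e = 0"
    using f xv(2) by simp
  then have "cinner e e = 0"
    unfolding cinner_add_left orth by simp
  then have "e = 0"
    by (simp add: cinner_self_eq_0_iff)
  then show thesis
    using that xv by simp
qed

text \<open>The resolvent \<open>(J - z)\<^sup>-\<^sup>1 f\<close> exists for all nonreal \<open>z\<close>, has norm at most
  \<open>\<parallel>f\<parallel> / \<bar>Im z\<bar>\<close>, and its first coordinate extends to an entire function of \<open>z\<close>.\<close>

lemma \<xi>_total:
  assumes f: "\<And>z. cinner f (\<xi> z) = 0"
  shows "f = 0"
proof -
  define \<phi> where "\<phi> z = (\<Sum>k. coord f k * Q z k)" for z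
  have \<phi>_entire: "\<phi> holomorphic_on UNIV"
    unfolding \<phi>_def by (rule entire_pairing_PQ(2)[OF coord_summable])
  \<comment> \<open>Green's identity against \<open>\<eta> (cnj z)\<close> isolates the first
    coordinate, because row 0 of \<open>Q\<close> has residue \<open>delta 0\<close>.\<close>
  have coord_0: "coord x 0 = \<phi> z" if "(x, v) \<in> J" "f = v - z *\<^sub>C x" for x v z
  proof -
    have "cinner (\<eta> (cnj z)) v = cinner (cnj z *\<^sub>C \<eta> (cnj z) + delta 0) x"
      by (rule green[OF \<eta>_Jmax that(1)])
    then have "cinner (\<eta> (cnj z)) f = coord x 0"
      by (simp add: that(2) cinner_diff_right cinner_scaleC_right cinner_add_left cinner_scaleC_left
          cinner_delta)
    moreover have "cinner (\<eta> (cnj z)) f = \<phi> z"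
      by (simp add: cinner_ell2_def \<phi>_def Q_cnj mult.commute)
    ultimately show ?thesis
      by simp
  qed
  have bound: "\<bar>Im z\<bar> * cmod (coord x k) \<le> norm f" if "(x, v) \<in> J" "f = v - z *\<^sub>C x" for x v z k
  proof -
    have "\<bar>Im z\<bar> * cmod (coord x k) \<le> \<bar>Im z\<bar> * norm x"
      by (intro mult_left_mono cmod_coord_le_norm) simp
    also have "\<dots> \<le> norm f"
      unfolding that(2) by (rule J_bounded_below[OF that(1)])
    finally show ?thesis .
  qed
  have "\<bar>Im z\<bar> * cmod (\<phi> z) \<le> norm f" for z
  proof (cases "Im z = 0")
    case False
    obtain x v where xv: "(x, v) \<in> J" "f = v - z *\<^sub>C x"
      using resolvent_if_orthogonal[OF f False] by blast
    show ?thesis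
      using bound[OF xv, of 0] unfolding coord_0[OF xv] .
  qed simp
  then have \<phi>: "\<phi> z = 0" for z
    by (rule entire_eq_0_if_Im_bounded[OF \<phi>_entire])
  \<comment> \<open>If entries 0 to k of every resolvent vanish, row k reads f k = b k x (k + 1).
    The left side does not depend on z, while the right side decays along the imaginary axis; so
    both are zero.\<close>
  have "(\<forall>j<k. coord f j = 0) \<and>
      (\<forall>z x v j. Im z \<noteq> 0 \<longrightarrow> (x, v) \<in> J \<longrightarrow> f = v - z *\<^sub>C x \<longrightarrow> j \<le> k \<longrightarrow> coord x j = 0)" for k
  proof (induction k)
    case 0
    then show ?case
      using coord_0 \<phi> by auto
  next
    case (Suc k)
    have f_k: "coord f k = b k * coord x (Suc k)"
      if "Im z \<noteq> 0" "(x, v) \<in> J" "f = v - z *\<^sub>C x" for z x v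
    proof -
      have zero: "coord x j = 0" if "j \<le> k" for j
        using Suc.IH \<open>Im z \<noteq> 0\<close> \<open>(x, v) \<in> J\<close> \<open>f = v - z *\<^sub>C x\<close> that by blast
      have "coord v k = L (coord x) k"
        using that(2) J_subset_Jmax JmaxD by blast
      also have "\<dots> = b k * coord x (Suc k)"
        by (simp add: L_def zero)
      finally show ?thesis
        using that(3) zero[of k] by simp
    qed
    have "t * cmod (coord f k) \<le> b k * norm f" if "0 < t" for t
    proof -
      have t: "Im (\<i> * t) \<noteq> 0"
        using that by simp
      obtain x v where xv: "(x, v) \<in> J" "f = v - (\<i> * t) *\<^sub>C x"
        using resolvent_if_orthogonal[OF f t] by blast
      have "t * cmod (coord x (Suc k)) \<le> norm f"
        using bound[OF xv, of "Suc k"] that by simp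
      then have "b k * (t * cmod (coord x (Suc k))) \<le> b k * norm f"
        using b_pos[of k] by (intro mult_left_mono) auto
      then show ?thesis
        using b_pos[of k] unfolding f_k[OF t xv] by (simp add: norm_mult mult_ac)
    qed
    \<comment> \<open>At this t the estimate would read b k |f| + 1 \<le> b k |f|, with |f| the norm
      of \<open>f\<close>.\<close>
    from this[of "(b k * norm f + 1) / cmod (coord f k)"] have f_0: "coord f k = 0"
      using b_pos[of k] by (cases "coord f k = 0") (auto simp: add_nonneg_pos)
    then have "coord x (Suc k) = 0" if "Im z \<noteq> 0" "(x, v) \<in> J" "f = v - z *\<^sub>C x" for z x v
      using f_k[OF that] by simp
    then show ?case
      using Suc.IH f_0 by (auto simp: less_Suc_eq le_Suc_eq)
  qed
  then show "f = 0"
    by (intro ell2_eqI) auto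
qed

section \<open>Uniqueness of the Jacobi basis\<close>

lemma jacobi_basis_unique:
  assumes "v \<in> jacobi_bases J"
  shows "equal_mod_phase delta v"
proof -
  have v: "orthonormal_basis v" and dom: "\<And>k. v k \<in> Domain J"
    and "jacobi_matrix (matrix_representation J v)"
    using assms by (auto simp: jacobi_bases_def basis_of_representation_def)
  then obtain q' b' :: "nat \<Rightarrow> real" where b': "\<And>k. 0 < b' k" and M: "\<And>k j. matrix_representation J v k j =
        (if j = k then complex_of_real (q' k)
         else if j = k + 1 then complex_of_real (b' k)
         else if k = j + 1 then complex_of_real (b' j)
         else 0)"
    unfolding jacobi_matrix_def by blast
  define A where "A n = op_apply J (v n)" for n
  have A: "(v n, A n) \<in> J" for n
    unfolding A_def by (rule op_apply_mem[OF linear_J dom])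
  have on: "cinner (v j) (v k) = (if j = k then 1 else 0)" for j k
    using v by (simp add: orthonormal_basis_def)
  have norm_v: "norm (v k) = 1" for k
  proof -
    have "complex_of_real ((norm (v k))\<^sup>2) = 1"
      unfolding cinner_self[symmetric] by (simp add: on)
    then have "(norm (v k))\<^sup>2 = 1\<^sup>2"
      unfolding of_real_eq_1_iff by simp
    then show ?thesis
      unfolding power2_eq_iff_nonneg[OF norm_ge_zero zero_le_one] .
  qed
  have M': "cinner (v k) (A j) = matrix_representation J v k j" for k j
    by (simp add: matrix_representation_def A_def)
  have A_expansion: "A j = (if j = 0 then 0 else complex_of_real (b' (j - 1)) *\<^sub>C v (j - 1))
      + complex_of_real (q' j) *\<^sub>C v j + complex_of_real (b' j) *\<^sub>C v (Suc j)" for j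
  proof -
    have "(\<lambda>k. cinner (v k) (A j) *\<^sub>C v k) sums A j"
      using v by (simp add: orthonormal_basis_def)
    \<comment> \<open>For j = 0 truncated subtraction makes j - 1 equal to j, and the index set has
      only two elements.\<close>
    moreover have "(\<lambda>k. cinner (v k) (A j) *\<^sub>C v k) sums (\<Sum>k\<in>{j - 1, j, Suc j}. cinner (v k) (A j) *\<^sub>C v k)"
      by (rule sums_finite) (auto simp: M' M)
    ultimately have "A j = (\<Sum>k\<in>{j - 1, j, Suc j}. cinner (v k) (A j) *\<^sub>C v k)"
      by (rule sums_unique2)
    then show ?thesis
      by (cases j) (simp_all add: M' M add.assoc)
  qed
  define G where "G z = cinner (v 0) (\<xi> z)" for z
  have G_eq: "G z = (\<Sum>k. cnj (coord (v 0) k) * P z k)" for z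
    by (simp add: G_def cinner_ell2_def)
  have cs: "summable (\<lambda>k. (cmod (cnj (coord (v 0) k)))\<^sup>2)"
    using coord_summable by simp
  have "G z \<noteq> 0" for z
  proof
    assume G0: "G z = 0"
    have eq: "cinner (\<xi> z) (A k) = cnj z * cinner (\<xi> z) (v k)" for k
      using green[OF \<xi>_Jmax A] by (simp add: cinner_scaleC_left)
    have "cinner (\<xi> z) (v k) = 0" for k
    proof (induction k rule: less_induct)
      case (less k)
      show ?case
      proof (cases k)
        case 0
        then show ?thesis
          using G0 unfolding G_def by (metis cinner_commute complex_cnj_zero)
      next
        case (Suc j)
        have "cinner (\<xi> z) (A j) = b' j * cinner (\<xi> z) (v (Suc j))"
          unfolding A_expansion[of j] using less.IH[of j] less.IH[of "j - 1"]
          by (simp add: Suc cinner_add_right cinner_scaleC_right)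
        then show ?thesis
          using eq[of j] less.IH[of j] b'[of j] by (simp add: Suc)
      qed
    qed
    then have "cinner (v k) (\<xi> z) = 0" for k
      by (metis cinner_commute complex_cnj_zero)
    moreover have "(\<lambda>k. cinner (v k) (\<xi> z) *\<^sub>C v k) sums \<xi> z"
      using v by (simp add: orthonormal_basis_def)
    ultimately have "(\<lambda>k. 0) sums \<xi> z"
      by simp
    then have "\<xi> z = 0"
      using sums_unique2 sums_zero by blast
    then show False
      using coord_\<xi>[of z 0] by simp
  qed
  moreover have "G holomorphic_on UNIV"
    "\<And>e. 0 < e \<Longrightarrow> \<exists>C. \<forall>z. cmod (G z) \<le> C * exp (e * cmod z)"
    unfolding G_eq[abs_def] using entire_pairing_PQ(1,3)[OF cs] by blast+
  ultimately obtain c where c: "\<And>z. G z = c"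
    using zero_free_minimal_type_const[of G] by metis
  \<comment> \<open>\<open>P z\<close> has first entry 1, so \<open>cnj c\<close> times
    \<open>delta 0\<close> pairs to c with every \<open>\<xi> z\<close>, just as \<open>v 0\<close>
    does.\<close>
  have "v 0 - cnj c *\<^sub>C delta 0 = 0"
  proof (rule \<xi>_total)
    show "cinner (v 0 - cnj c *\<^sub>C delta 0) (\<xi> z) = 0" for z
      using c[of z] by (simp add: G_def cinner_diff_left cinner_scaleC_left cinner_delta)
  qed
  then have v0: "v 0 = cnj c *\<^sub>C delta 0"
    by simp
  define d where "d = cnj c"
  have d: "cmod d = 1"
    using norm_v[of 0] unfolding v0 d_def by (simp add: norm_scaleC)
  have A_delta: "A k = d *\<^sub>C Jdelta k" if "v k = d *\<^sub>C delta k" for k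
  proof -
    have "(v k, d *\<^sub>C Jdelta k) \<in> J"
      unfolding that by (intro linear_operatorD(4)[OF linear_J] delta_Jdelta)
    then show ?thesis
      using A linear_operatorD(1)[OF linear_J] by blast
  qed
  have dd: "d * cnj d = 1"
    using complex_norm_square[of d] d by simp
  have "\<forall>j\<le>k. v j = d *\<^sub>C delta j" for k
  proof (induction k)
    case 0
    show ?case
      by (simp add: v0 d_def)
  next
    case (Suc k)
    then have vk: "v k = d *\<^sub>C delta k" and vk1: "k \<noteq> 0 \<Longrightarrow> v (k - 1) = d *\<^sub>C delta (k - 1)"
      by auto
    have inner: "cinner (d *\<^sub>C x) (d *\<^sub>C y) = cinner x y" for x y :: ell2
      using dd by (simp add: cinner_scaleC_left cinner_scaleC_right mult.assoc[symmetric])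
    have "complex_of_real (q' k) = cinner (v k) (A k)"
      by (simp add: M' M)
    also have "\<dots> = q k"
      unfolding A_delta[OF vk] vk inner by (cases k) (simp_all add: cinner_delta Jdelta_def)
    finally have q: "q' k = q k"
      by simp
    have b: "b' (k - 1) = b (k - 1)" if "k \<noteq> 0"
    proof -
      have "complex_of_real (b' (k - 1)) = cinner (v (k - 1)) (A k)"
        using that by (cases k) (simp_all add: M' M)
      also have "\<dots> = b (k - 1)"
        unfolding A_delta[OF vk] vk1[OF that] inner using that by (cases k) (simp_all add: cinner_delta Jdelta_def)
      finally show ?thesis
        by simp
    qed
    \<comment> \<open>The two expansions of \<open>J (v k)\<close> agree in their diagonal and lower
      terms, so the upper terms agree; taking norms then gives b' k = b k by positivity.\<close>
    have eq: "complex_of_real (b' k) *\<^sub>C v (Suc k) = complex_of_real (b k) *\<^sub>C (d *\<^sub>C delta (Suc k))"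
    proof -
      have "A k = d *\<^sub>C Jdelta k"
        by (rule A_delta[OF vk])
      then show ?thesis
        unfolding A_expansion[of k] Jdelta_def using vk vk1 q b
        by (cases "k = 0") (simp_all add: scaleC_add_right mult.commute)
    qed
    then have "norm (complex_of_real (b' k) *\<^sub>C v (Suc k)) = norm (complex_of_real (b k) *\<^sub>C (d *\<^sub>C delta (Suc k)))"
      by simp
    then have "b' k = b k"
      using b'[of k] b_pos[of k] by (simp add: norm_scaleC norm_v norm_mult d)
    then have "v (Suc k) = d *\<^sub>C delta (Suc k)"
      using eq b_nonzero[of k] by (simp only: cvec.scale_cancel_left) simp
    then show ?case
      using Suc by (auto simp: le_Suc_eq)
  qed
  then show ?thesis
    unfolding equal_mod_phase_def using d by blast
qed

end

text \<open>This combines symmetry and transitivity; it will compare two bases through a common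
  one.\<close>

lemma equal_mod_phase_common:
  assumes "equal_mod_phase u v" "equal_mod_phase u w"
  shows "equal_mod_phase v w"
proof -
  obtain c d where c: "cmod c = 1" "\<And>k. v k = c *\<^sub>C u k" and d: "cmod d = 1" "\<And>k. w k = d *\<^sub>C u k"
    using assms unfolding equal_mod_phase_def by blast
  have "c \<noteq> 0"
    using c(1) by auto
  then have "w k = (d / c) *\<^sub>C v k" for k
    by (simp add: c(2) d(2))
  moreover have "cmod (d / c) = 1"
    by (simp add: norm_divide c(1) d(1))
  ultimately show ?thesis
    unfolding equal_mod_phase_def by blast
qed

theorem mainTheorem1:
  fixes J :: "(ell2 \<times> ell2) set"
  assumes "jacobi_operator J"
  shows "((\<exists>u\<in>jacobi_bases J. \<exists>v\<in>jacobi_bases J. \<not> equal_mod_phase u v)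
            \<longrightarrow> selfadjoint J) \<and>
         ((\<exists>u\<in>jacobi_bases J. \<forall>v\<in>jacobi_bases J. equal_mod_phase u v)
            \<longrightarrow> \<not> selfadjoint J)"
proof -
  obtain q b where b: "\<And>k. 0 < b k" and J: "J = closure (jacobi_finite q b)"
    using assms by (auto simp: jacobi_operator_def)
  interpret jacobi q b
    by unfold_locales (rule b)
  have J: "J = local.J"
    by (simp add: J J_def)
  show ?thesis
    unfolding J
  proof (intro conjI impI)
    assume *: "\<exists>u\<in>jacobi_bases local.J. \<exists>v\<in>jacobi_bases local.J. \<not> equal_mod_phase u v"
    show "selfadjoint local.J"
    proof (rule ccontr)
      assume "\<not> selfadjoint local.J"
      then interpret limit_circle q b
        by unfold_locales (rule P_square_summable_if_not_selfadjoint)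
      \<comment> \<open>Both bases are phase multiples of \<open>delta\<close>, hence of each
        other.\<close>
      show False
        using * jacobi_basis_unique equal_mod_phase_common by blast
    qed
  next
    assume *: "\<exists>u\<in>jacobi_bases local.J. \<forall>v\<in>jacobi_bases local.J. equal_mod_phase u v"
    \<comment> \<open>Were \<open>J\<close> selfadjoint, \<open>u\<close> would be phase-equal to
      both \<open>delta\<close> and the second basis, which are not phase-equal to each
      other.\<close>
    show "\<not> selfadjoint local.J"
      using * second_jacobi_basis delta_in_jacobi_bases equal_mod_phase_common by blast
  qed
qed

end
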